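(* Fix a Coxeter group $W$ with simple reflections indexed by $I$ and Coxeter matrix $(m_{ij})_{i,j\in I}$, and integers $d_i\geqslant 2$ for all $i\in I$; put $\mathbf d=(d_i)_{i\in I}$. The corresponding nil-Hecke $\Bbbk$-algebra $n\mathcal H(W,\mathbf d,J_{<1})=n\mathcal H(W,\mathbf d,J_{<2})$ is a finitely generated $\Bbbk$-module if and only if exactly one of the following occurs: (1) The Coxeter (multi)graph of $W$ is a tree with exactly one multiple edge $4\leqslant m_{i_0j_0}<\infty$ (with endpoints $i_0,j_0$), and $d_i=2$ for all $i$. In this case, if disconnecting $i_0,j_0$ (i.e. deleting the edge between them) yields trees $T,T'$ with $a,b$ nodes respectively, then $$\dim n\mathcal H(W,\mathbf d,J_{<2})=\begin{cases}\frac12 m_{i_0j_0}|I|^2+1-2ab, & \text{if } m_{i_0j_0}\text{ is even},\\ \frac12(m_{i_0j_0}-1)|I|^2+1, & \text{if } m_{i_0j_0}\text{ is odd}.\end{cases}$$ (2) The Coxeter (multi)graph of $W$ is a simply laced tree, and at most one node $i_0\in I$ satisfies $d_{i_0}\geqslant 3$. In this case, $$\dim n\mathcal H(W,\mathbf d,J_{<2})=1+|I|^2(d_{i_0}-1)$$ (where $d_{i_0}$ is read as $2$ if no node satisfies $d_{i_0}\geqslant 3$).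
   Context: $\Bbbk$ is a fixed unital commutative ring. A Coxeter group $W$ has a finite index set $I$ of simple reflections and a Coxeter matrix $(m_{ij})_{i,j\in I}$ with $m_{ii}=1$ and $m_{ij}=m_{ji}\in\{2,3,\dots,\infty\}$ for $i\ne j$. Let $J$ be the set of unordered pairs $\{a,b\}\subset I$, $a\neq b$, with $m_{ab}<\infty$. For $j=\{a,b\}\in J$ let $\mathbf v_j=\mathbf s_a\mathbf s_b\mathbf s_a\cdots$ and $\mathbf w_j=\mathbf s_b\mathbf s_a\mathbf s_b\cdots$ be the two alternating words with $m_{ab}$ letters each; these are the two sides of the braid relation for $j$, whose length is $\ell(\mathbf v_j)=\ell(\mathbf w_j)=m_{ab}$. For $J_0\subset J$ and $\mathbf d=(d_i)_{i\in I}$ with integers $d_i\geqslant 2$, the nil-Hecke algebra $n\mathcal H(W,\mathbf d,J_0)$ is the associative unital $\Bbbk$-algebra generated by $\{\mathbf s_i:i\in I\}$ with relations $$\mathbf s_i^{d_i}=0\ (i\in I),\qquad \mathbf v_j=\mathbf w_j\ (j\in J_0),\qquad \mathbf v_j=0=\mathbf w_j\ (j\in J\setminus J_0).$$ For $k\geqslant 1$ put $J_{<k}=\{j\in J:\ell(\mathbf v_j)=\ell(\mathbf w_j)<k\}$; thus $J_{<1}=J_{<2}=\emptyset$. The Coxeter multigraph of $W$ has node set $I$ and $m_{ij}-2$ edges between $i\neq j$; two nodes are adjacent iff $m_{ij}\geqslant 3$. An edge is multiple if $m_{ij}\geqslant 4$; "tree" refers to the underlying simple graph being a tree; "simply laced"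 means all $m_{ij}\leqslant 3$. The statement $\dim M=m$ means that $M$ is a free $\Bbbk$-module of rank $m$.
   Formalization: The Coxeter graph of W is assumed connected (W irreducible) and the ground ring nonzero; otherwise "only if" fails, e.g. two nodes with m=2 and d=(2,2) give a free algebra of rank 3 though the graph is not a tree. *)

theory Defs
  imports
    "HOL-Algebra.QuotRing"
    "HOL-Algebra.Module"
    "HOL-Library.Extended_Nat"
    "Jordan_Normal_Form.Missing_VectorSpace"
begin

section \<open>Simple graphs\<close>

text \<open>
  A graph is given by a vertex set and a set of two-element vertex sets. The graph without
  vertices counts as connected, hence as a tree.
\<close>

definition reachable :: "'v set set \<Rightarrow> ('v \<times> 'v) set" where
  "reachable E = {(u, v). {u, v} \<in> E}\<^sup>*"

definition component :: "'v set \<Rightarrow> 'v set set \<Rightarrow> 'v \<Rightarrow> 'v set" where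
  "component V E u = {v \<in> V. (u, v) \<in> reachable E}"

definition connected_graph :: "'v set \<Rightarrow> 'v set set \<Rightarrow> bool" where
  "connected_graph V E \<longleftrightarrow> (\<forall>u\<in>V. \<forall>v\<in>V. (u, v) \<in> reachable E)"

definition graph_cycle :: "'v set set \<Rightarrow> 'v list \<Rightarrow> bool" where
  "graph_cycle E c \<longleftrightarrow> 3 \<le> length c \<and> distinct c \<and>
     successively (\<lambda>u v. {u, v} \<in> E) c \<and> {last c, hd c} \<in> E"

definition is_tree :: "'v set \<Rightarrow> 'v set set \<Rightarrow> bool" where
  "is_tree V E \<longleftrightarrow> connected_graph V E \<and> (\<nexists>c. graph_cycle E c)"


section \<open>Coxeter matrices and Coxeter graphs\<close>

definition coxeter_matrix :: "'i set \<Rightarrow> ('i \<Rightarrow> 'i \<Rightarrow> enat) \<Rightarrow> bool" where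
  "coxeter_matrix I m \<longleftrightarrow> finite I \<and> (\<forall>i\<in>I. m i i = 1) \<and>
     (\<forall>i\<in>I. \<forall>j\<in>I. i \<noteq> j \<longrightarrow> m i j = m j i \<and> 2 \<le> m i j)"

definition coxeter_edges :: "'i set \<Rightarrow> ('i \<Rightarrow> 'i \<Rightarrow> enat) \<Rightarrow> 'i set set" where
  "coxeter_edges I m = {{i, j} | i j. i \<in> I \<and> j \<in> I \<and> i \<noteq> j \<and> 3 \<le> m i j}"

definition multiple_edges :: "'i set \<Rightarrow> ('i \<Rightarrow> 'i \<Rightarrow> enat) \<Rightarrow> 'i set set" where
  "multiple_edges I m = {{i, j} | i j. i \<in> I \<and> j \<in> I \<and> i \<noteq> j \<and> 4 \<le> m i j}"

definition simply_laced :: "'i set \<Rightarrow> ('i \<Rightarrow> 'i \<Rightarrow> enat) \<Rightarrow> bool" where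
  "simply_laced I m \<longleftrightarrow> (\<forall>i\<in>I. \<forall>j\<in>I. m i j \<le> 3)"

definition braid_pairs :: "'i set \<Rightarrow> ('i \<Rightarrow> 'i \<Rightarrow> enat) \<Rightarrow> 'i set set" where
  "braid_pairs I m = {{a, b} | a b. a \<in> I \<and> b \<in> I \<and> a \<noteq> b \<and> m a b < \<infinity>}"

definition braid_pairs_lt :: "'i set \<Rightarrow> ('i \<Rightarrow> 'i \<Rightarrow> enat) \<Rightarrow> nat \<Rightarrow> 'i set set" where
  "braid_pairs_lt I m k =
     {{a, b} | a b. {a, b} \<in> braid_pairs I m \<and> m a b < enat k}"

primrec alternating :: "'i \<Rightarrow> 'i \<Rightarrow> nat \<Rightarrow> 'i list" where
  "alternating a b 0 = []"
| "alternating a b (Suc n) = a # alternating b a n"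


section \<open>Free associative algebras\<close>

text \<open>
  The free associative unital \<open>K\<close>-algebra on \<open>I\<close>: finitely supported functions on words over
  \<open>I\<close>, with convolution as multiplication.
\<close>

definition free_algebra :: "('k, 'r) ring_scheme \<Rightarrow> 'i set \<Rightarrow> ('k, 'i list \<Rightarrow> 'k) module" where
  "free_algebra K I =
    \<lparr>carrier = {f. (\<forall>w. f w \<in> carrier K) \<and> finite {w. f w \<noteq> \<zero>\<^bsub>K\<^esub>} \<and>
                   {w. f w \<noteq> \<zero>\<^bsub>K\<^esub>} \<subseteq> lists I},
     monoid.mult = (\<lambda>f g w. \<Oplus>\<^bsub>K\<^esub>p\<in>{(u, v). u @ v = w}. f (fst p) \<otimes>\<^bsub>K\<^esub> g (snd p)),
     monoid.one = (\<lambda>w. if w = [] then \<one>\<^bsub>K\<^esub> else \<zero>\<^bsub>K\<^esub>),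
     ring.zero = (\<lambda>w. \<zero>\<^bsub>K\<^esub>),
     ring.add = (\<lambda>f g w. f w \<oplus>\<^bsub>K\<^esub> g w),
     module.smult = (\<lambda>c f w. c \<otimes>\<^bsub>K\<^esub> f w)\<rparr>"

definition word_monom :: "('k, 'r) ring_scheme \<Rightarrow> 'i list \<Rightarrow> 'i list \<Rightarrow> 'k" where
  "word_monom K u = (\<lambda>w. if w = u then \<one>\<^bsub>K\<^esub> else \<zero>\<^bsub>K\<^esub>)"


section \<open>Nil-Hecke algebras\<close>

text \<open>
  The library's quotient ring, with scalar multiplication defined on cosets in the same way as
  its multiplication.
\<close>

definition quotient_algebra ::
  "('k, 'a, 'm) module_scheme \<Rightarrow> 'a set \<Rightarrow> ('k, 'a set) module" where
  "quotient_algebra A N =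
    \<lparr>carrier = carrier (A Quot N),
     monoid.mult = monoid.mult (A Quot N),
     monoid.one = monoid.one (A Quot N),
     ring.zero = ring.zero (A Quot N),
     ring.add = ring.add (A Quot N),
     module.smult = (\<lambda>c C. \<Union>x\<in>C. N +>\<^bsub>A\<^esub> (c \<odot>\<^bsub>A\<^esub> x))\<rparr>"

text \<open>
  An unordered pair \<open>{a, b}\<close> contributes both \<open>(a, b)\<close> and \<open>(b, a)\<close> below, so both alternating
  words of a pair outside \<open>J0\<close> are killed.
\<close>

definition nil_hecke_relators ::
  "('k, 'r) ring_scheme \<Rightarrow> 'i set \<Rightarrow> ('i \<Rightarrow> 'i \<Rightarrow> enat) \<Rightarrow> ('i \<Rightarrow> nat) \<Rightarrow> 'i set set \<Rightarrow>
    ('i list \<Rightarrow> 'k) set" where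
  "nil_hecke_relators K I m d J0 =
     {word_monom K (replicate (d i) i) | i. i \<in> I} \<union>
     {word_monom K (alternating a b (the_enat (m a b))) \<ominus>\<^bsub>free_algebra K I\<^esub>
        word_monom K (alternating b a (the_enat (m a b))) | a b. {a, b} \<in> J0} \<union>
     {word_monom K (alternating a b (the_enat (m a b))) | a b. {a, b} \<in> braid_pairs I m - J0}"

definition nil_hecke ::
  "('k, 'r) ring_scheme \<Rightarrow> 'i set \<Rightarrow> ('i \<Rightarrow> 'i \<Rightarrow> enat) \<Rightarrow> ('i \<Rightarrow> nat) \<Rightarrow> 'i set set \<Rightarrow>
    ('k, ('i list \<Rightarrow> 'k) set) module" where
  "nil_hecke K I m d J0 = quotient_algebra (free_algebra K I)
     (genideal (free_algebra K I) (nil_hecke_relators K I m d J0))"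


section \<open>Finitely generated modules and free modules of finite rank\<close>

definition fin_gen_module :: "('k, 'r) ring_scheme \<Rightarrow> ('k, 'a, 'm) module_scheme \<Rightarrow> bool" where
  "fin_gen_module K M \<longleftrightarrow> module K M \<and>
     (\<exists>S. finite S \<and> S \<subseteq> carrier M \<and> LinearCombinations.module.span K M S = carrier M)"

definition free_of_rank ::
  "('k, 'r) ring_scheme \<Rightarrow> ('k, 'a, 'm) module_scheme \<Rightarrow> nat \<Rightarrow> bool" where
  "free_of_rank K M n \<longleftrightarrow> module K M \<and>
     (\<exists>B. finite B \<and> card B = n \<and> B \<subseteq> carrier M \<and>
        \<not> module.lin_dep K M B \<and> LinearCombinations.module.span K M B = carrier M)"


section \<open>The two cases of the classification\<close>

definition one_multiple_edge_case ::
  "'i set \<Rightarrow> ('i \<Rightarrow> 'i \<Rightarrow> enat) \<Rightarrow> ('i \<Rightarrow> nat) \<Rightarrow> 'i \<Rightarrow> 'i \<Rightarrow> bool" where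
  "one_multiple_edge_case I m d i0 j0 \<longleftrightarrow>
     is_tree I (coxeter_edges I m) \<and>
     multiple_edges I m = {{i0, j0}} \<and> 4 \<le> m i0 j0 \<and> m i0 j0 < \<infinity> \<and>
     (\<forall>i\<in>I. d i = 2)"

definition simply_laced_case ::
  "'i set \<Rightarrow> ('i \<Rightarrow> 'i \<Rightarrow> enat) \<Rightarrow> ('i \<Rightarrow> nat) \<Rightarrow> bool" where
  "simply_laced_case I m d \<longleftrightarrow>
     is_tree I (coxeter_edges I m) \<and> simply_laced I m \<and>
     (\<forall>i\<in>I. \<forall>j\<in>I. 3 \<le> d i \<and> 3 \<le> d j \<longrightarrow> i = j)"


section \<open>The nil-Hecke algebra is a ring and a module\<close>

lemma (in comm_monoid) finprod_Sigma:
  assumes "finite A" "\<And>a. a \<in> A \<Longrightarrow> finite (B a)"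
    and "\<And>a b. a \<in> A \<Longrightarrow> b \<in> B a \<Longrightarrow> f a b \<in> carrier G"
  shows "finprod G (\<lambda>a. finprod G (f a) (B a)) A = finprod G (\<lambda>p. f (fst p) (snd p)) (Sigma A B)"
  using assms
proof (induction A rule: finite_induct)
  case empty
  then show ?case by simp
next
  case (insert a A)
  have S: "Sigma (insert a A) B = Pair a ` B a \<union> Sigma A B" by auto
  have "finprod G (\<lambda>p. f (fst p) (snd p)) (Sigma (insert a A) B)
      = finprod G (\<lambda>p. f (fst p) (snd p)) (Pair a ` B a) \<otimes> finprod G (\<lambda>p. f (fst p) (snd p)) (Sigma A B)"
    unfolding S using insert by (intro finprod_Un_disjoint) auto
  also have "finprod G (\<lambda>p. f (fst p) (snd p)) (Pair a ` B a) = finprod G (f a) (B a)"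
    using insert by (subst finprod_reindex) (auto simp: inj_on_def)
  also have "finprod G (\<lambda>p. f (fst p) (snd p)) (Sigma A B) = finprod G (\<lambda>a. finprod G (f a) (B a)) A"
    using insert by simp
  also have "finprod G (f a) (B a) \<otimes> \<dots> = finprod G (\<lambda>a. finprod G (f a) (B a)) (insert a A)"
    using insert by (subst finprod_insert) (auto intro!: finprod_closed)
  finally show ?case ..
qed

lemma finite_splits: "finite {(u, v). u @ v = w}"
proof -
  have "(u, v) \<in> (\<lambda>n. (take n w, drop n w)) ` {..length w}" if "u @ v = w" for u v
    by (rule image_eqI[of _ _ "length u"]) (simp_all flip: that)
  then have "{(u, v). u @ v = w} \<subseteq> (\<lambda>n. (take n w, drop n w)) ` {..length w}"
    by blast
  then show ?thesis by (rule finite_subset) simp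
qed

context cring
begin

lemma free_algebra_carrierD:
  assumes "f \<in> carrier (free_algebra R I)"
  shows "f w \<in> carrier R" "finite {w. f w \<noteq> \<zero>}" "f w \<noteq> \<zero> \<Longrightarrow> w \<in> lists I"
  using assms by (auto simp: free_algebra_def)

lemma free_algebra_mult_closed:
  assumes f: "f \<in> carrier (free_algebra R I)" and g: "g \<in> carrier (free_algebra R I)"
  shows "f \<otimes>\<^bsub>free_algebra R I\<^esub> g \<in> carrier (free_algebra R I)"
proof -
  have *: "\<exists>u v. w = u @ v \<and> f u \<noteq> \<zero> \<and> g v \<noteq> \<zero>" if "(f \<otimes>\<^bsub>free_algebra R I\<^esub> g) w \<noteq> \<zero>" for w
  proof (rule ccontr)
    assume H: "\<not> ?thesis"
    have "(f \<otimes>\<^bsub>free_algebra R I\<^esub> g) w = (\<Oplus>p\<in>{(u, v). u @ v = w}. \<zero>)"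
      unfolding free_algebra_def monoid.simps partial_object.simps
      by (rule finsum_cong') (use H free_algebra_carrierD[OF f] free_algebra_carrierD[OF g] in \<open>auto, metis l_null r_null\<close>)
    then show False using that by simp
  qed
  have "{w. (f \<otimes>\<^bsub>free_algebra R I\<^esub> g) w \<noteq> \<zero>} \<subseteq> (\<lambda>(u,v). u @ v) ` ({u. f u \<noteq> \<zero>} \<times> {v. g v \<noteq> \<zero>})"
    using * by fast
  then have 1: "finite {w. (f \<otimes>\<^bsub>free_algebra R I\<^esub> g) w \<noteq> \<zero>}"
    using free_algebra_carrierD(2)[OF f] free_algebra_carrierD(2)[OF g] by (auto intro: finite_subset)
  have 2: "{w. (f \<otimes>\<^bsub>free_algebra R I\<^esub> g) w \<noteq> \<zero>} \<subseteq> lists I"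
    using * free_algebra_carrierD(3)[OF f] free_algebra_carrierD(3)[OF g] by fastforce
  have 3: "(f \<otimes>\<^bsub>free_algebra R I\<^esub> g) w \<in> carrier R" for w
    unfolding free_algebra_def monoid.simps partial_object.simps
    by (rule finsum_closed) (use free_algebra_carrierD[OF f] free_algebra_carrierD[OF g] in auto)
  show ?thesis using 1 2 3 by (simp add: free_algebra_def)
qed

lemma free_algebra_mult_assoc:
  fixes f g h :: "'i list \<Rightarrow> 'a"
  assumes f: "f \<in> carrier (free_algebra R I)" and g: "g \<in> carrier (free_algebra R I)" and h: "h \<in> carrier (free_algebra R I)"
  shows "(f \<otimes>\<^bsub>free_algebra R I\<^esub> g) \<otimes>\<^bsub>free_algebra R I\<^esub> h = f \<otimes>\<^bsub>free_algebra R I\<^esub> (g \<otimes>\<^bsub>free_algebra R I\<^esub> h)"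
proof
  fix w :: "'i list"
  note c = free_algebra_carrierD(1)[OF f] free_algebra_carrierD(1)[OF g] free_algebra_carrierD(1)[OF h]
  let ?S = "\<lambda>w. {(u, v). u @ v = w}"
  let ?T = "{(x, y, z). x @ y @ z = w}"
  let ?F = "\<lambda>(x, y, z). f x \<otimes> g y \<otimes> h z"
  let ?L = "Sigma (?S w) (\<lambda>p. ?S (fst p))"
  let ?R = "Sigma (?S w) (\<lambda>p. ?S (snd p))"
  let ?l = "\<lambda>(p, q). (fst q, snd q, snd p)"
  let ?r = "\<lambda>(p, q). (fst p, fst q, snd q)"
  have "((f \<otimes>\<^bsub>free_algebra R I\<^esub> g) \<otimes>\<^bsub>free_algebra R I\<^esub> h) w
      = (\<Oplus>p\<in>?S w. (\<Oplus>q\<in>?S (fst p). f (fst q) \<otimes> g (snd q)) \<otimes> h (snd p))"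
    by (simp add: free_algebra_def)
  also have "\<dots> = (\<Oplus>p\<in>?S w. (\<Oplus>q\<in>?S (fst p). f (fst q) \<otimes> g (snd q) \<otimes> h (snd p)))"
    by (rule finsum_cong') (auto simp: finite_splits c intro!: finsum_ldistr finsum_closed)
  also have "\<dots> = (\<Oplus>t\<in>?L. f (fst (snd t)) \<otimes> g (snd (snd t)) \<otimes> h (snd (fst t)))"
    by (subst add.finprod_Sigma) (auto simp: finite_splits c)
  also have "\<dots> = (\<Oplus>t\<in>?L. ?F (?l t))"
    by (rule finsum_cong') (auto simp: c)
  also have "\<dots> = (\<Oplus>t\<in>?l ` ?L. ?F t)"
    by (rule add.finprod_reindex[symmetric]) (auto simp: c inj_on_def)
  also have "?l ` ?L = ?T" by (auto simp: image_iff)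
  also have "(\<Oplus>t\<in>?T. ?F t) = (\<Oplus>t\<in>?r ` ?R. ?F t)"
  proof -
    have "?r ` ?R = ?T" by (auto simp: image_iff)
    then show ?thesis by simp
  qed
  also have "\<dots> = (\<Oplus>t\<in>?R. ?F (?r t))"
    by (rule add.finprod_reindex) (auto simp: c inj_on_def)
  also have "\<dots> = (\<Oplus>t\<in>?R. f (fst (fst t)) \<otimes> (g (fst (snd t)) \<otimes> h (snd (snd t))))"
    by (rule finsum_cong') (auto simp: c m_assoc)
  also have "\<dots> = (\<Oplus>p\<in>?S w. (\<Oplus>q\<in>?S (snd p). f (fst p) \<otimes> (g (fst q) \<otimes> h (snd q))))"
    by (subst add.finprod_Sigma) (auto simp: finite_splits c)
  also have "\<dots> = (\<Oplus>p\<in>?S w. f (fst p) \<otimes> (\<Oplus>q\<in>?S (snd p). g (fst q) \<otimes> h (snd q)))"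
    by (rule finsum_cong') (auto simp: finite_splits c intro!: finsum_rdistr[symmetric] finsum_closed)
  also have "\<dots> = (f \<otimes>\<^bsub>free_algebra R I\<^esub> (g \<otimes>\<^bsub>free_algebra R I\<^esub> h)) w"
    by (simp add: free_algebra_def)
  finally show "((f \<otimes>\<^bsub>free_algebra R I\<^esub> g) \<otimes>\<^bsub>free_algebra R I\<^esub> h) w = (f \<otimes>\<^bsub>free_algebra R I\<^esub> (g \<otimes>\<^bsub>free_algebra R I\<^esub> h)) w" .
qed

lemma free_algebra_mult_one:
  assumes f: "f \<in> carrier (free_algebra R I)"
  shows "\<one>\<^bsub>free_algebra R I\<^esub> \<otimes>\<^bsub>free_algebra R I\<^esub> f = f" "f \<otimes>\<^bsub>free_algebra R I\<^esub> \<one>\<^bsub>free_algebra R I\<^esub> = f"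
proof -
  note c = free_algebra_carrierD(1)[OF f]
  show "\<one>\<^bsub>free_algebra R I\<^esub> \<otimes>\<^bsub>free_algebra R I\<^esub> f = f"
  proof
    fix w
    have "(\<one>\<^bsub>free_algebra R I\<^esub> \<otimes>\<^bsub>free_algebra R I\<^esub> f) w = (\<Oplus>p\<in>{(u, v). u @ v = w}. if p = ([], w) then f (snd p) else \<zero>)"
      unfolding free_algebra_def monoid.simps partial_object.simps
      by (rule finsum_cong') (auto simp: c)
    also have "\<dots> = (\<Oplus>p\<in>{(u, v). u @ v = w}. if ([], w) = p then f (snd p) else \<zero>)"
      by (rule finsum_cong') (auto simp: c)
    also have "\<dots> = f w"
      using add.finprod_singleton[of "([], w)" "{(u, v). u @ v = w}" "\<lambda>p. f (snd p)"]
      by (simp add: finite_splits c Pi_def)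
    finally show "(\<one>\<^bsub>free_algebra R I\<^esub> \<otimes>\<^bsub>free_algebra R I\<^esub> f) w = f w" .
  qed
  show "f \<otimes>\<^bsub>free_algebra R I\<^esub> \<one>\<^bsub>free_algebra R I\<^esub> = f"
  proof
    fix w
    have "(f \<otimes>\<^bsub>free_algebra R I\<^esub> \<one>\<^bsub>free_algebra R I\<^esub>) w = (\<Oplus>p\<in>{(u, v). u @ v = w}. if (w, []) = p then f (fst p) else \<zero>)"
      unfolding free_algebra_def monoid.simps partial_object.simps
      by (rule finsum_cong') (auto simp: c)
    also have "\<dots> = f w"
      using add.finprod_singleton[of "(w, [])" "{(u, v). u @ v = w}" "\<lambda>p. f (fst p)"]
      by (simp add: finite_splits c Pi_def)
    finally show "(f \<otimes>\<^bsub>free_algebra R I\<^esub> \<one>\<^bsub>free_algebra R I\<^esub>) w = f w" .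
  qed
qed

lemma free_algebra_add_closed:
  assumes f: "f \<in> carrier (free_algebra R I)" and g: "g \<in> carrier (free_algebra R I)"
  shows "f \<oplus>\<^bsub>free_algebra R I\<^esub> g \<in> carrier (free_algebra R I)"
proof -
  have "{w. f w \<oplus> g w \<noteq> \<zero>} \<subseteq> {w. f w \<noteq> \<zero>} \<union> {w. g w \<noteq> \<zero>}" by auto
  then have "finite {w. f w \<oplus> g w \<noteq> \<zero>}"
    by (rule finite_subset)
      (use free_algebra_carrierD(2)[OF f] free_algebra_carrierD(2)[OF g] in simp)
  moreover have "w \<in> lists I" if "f w \<oplus> g w \<noteq> \<zero>" for w
    using that free_algebra_carrierD(3)[OF f] free_algebra_carrierD(3)[OF g] by (metis l_zero zero_closed)
  ultimately show ?thesis
    using free_algebra_carrierD(1)[OF f] free_algebra_carrierD(1)[OF g] by (auto simp: free_algebra_def simp del: in_lists_conv_set)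
qed

lemma free_algebra_smult_closed:
  assumes f: "f \<in> carrier (free_algebra R I)" and a: "a \<in> carrier R"
  shows "a \<odot>\<^bsub>free_algebra R I\<^esub> f \<in> carrier (free_algebra R I)"
proof -
  have "{w. a \<otimes> f w \<noteq> \<zero>} \<subseteq> {w. f w \<noteq> \<zero>}" using a by auto
  then have "finite {w. a \<otimes> f w \<noteq> \<zero>}"
    by (rule finite_subset) (rule free_algebra_carrierD(2)[OF f])
  moreover have "w \<in> lists I" if "a \<otimes> f w \<noteq> \<zero>" for w
    using that free_algebra_carrierD(3)[OF f] a by (metis r_null)
  ultimately show ?thesis
    using free_algebra_carrierD(1)[OF f] a by (auto simp: free_algebra_def simp del: in_lists_conv_set)
qed

lemma free_algebra_ring: "ring (free_algebra R I)"
proof (rule ringI)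
  show "abelian_group (free_algebra R I)"
  proof (rule abelian_groupI)
    fix f assume f: "f \<in> carrier (free_algebra R I)"
    have "(\<ominus> \<one>) \<odot>\<^bsub>free_algebra R I\<^esub> f \<oplus>\<^bsub>free_algebra R I\<^esub> f = \<zero>\<^bsub>free_algebra R I\<^esub>"
      using free_algebra_carrierD(1)[OF f] by (auto simp: free_algebra_def l_minus l_neg)
    then show "\<exists>y\<in>carrier (free_algebra R I). y \<oplus>\<^bsub>free_algebra R I\<^esub> f = \<zero>\<^bsub>free_algebra R I\<^esub>"
      using free_algebra_smult_closed[OF f] by blast
  next
    fix f g assume "f \<in> carrier (free_algebra R I)" "g \<in> carrier (free_algebra R I)"
    then show "f \<oplus>\<^bsub>free_algebra R I\<^esub> g \<in> carrier (free_algebra R I)" by (rule free_algebra_add_closed)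
  qed (auto simp: free_algebra_def a_ac)
  show "monoid (free_algebra R I)"
  proof (rule monoidI)
    show "\<one>\<^bsub>free_algebra R I\<^esub> \<in> carrier (free_algebra R I)" by (auto simp: free_algebra_def)
  qed (auto simp: free_algebra_mult_closed free_algebra_mult_assoc free_algebra_mult_one)
next
  fix f g h assume A: "f \<in> carrier (free_algebra R I)" "g \<in> carrier (free_algebra R I)" "h \<in> carrier (free_algebra R I)"
  note c = free_algebra_carrierD(1)[OF A(1)] free_algebra_carrierD(1)[OF A(2)] free_algebra_carrierD(1)[OF A(3)]
  show "(f \<oplus>\<^bsub>free_algebra R I\<^esub> g) \<otimes>\<^bsub>free_algebra R I\<^esub> h = f \<otimes>\<^bsub>free_algebra R I\<^esub> h \<oplus>\<^bsub>free_algebra R I\<^esub> g \<otimes>\<^bsub>free_algebra R I\<^esub> h"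
  proof
    fix w
    have "((f \<oplus>\<^bsub>free_algebra R I\<^esub> g) \<otimes>\<^bsub>free_algebra R I\<^esub> h) w = (\<Oplus>p\<in>{(u, v). u @ v = w}. f (fst p) \<otimes> h (snd p) \<oplus> g (fst p) \<otimes> h (snd p))"
      unfolding free_algebra_def monoid.simps partial_object.simps ring.simps
      by (rule finsum_cong') (auto simp: c l_distr)
    also have "\<dots> = (f \<otimes>\<^bsub>free_algebra R I\<^esub> h \<oplus>\<^bsub>free_algebra R I\<^esub> g \<otimes>\<^bsub>free_algebra R I\<^esub> h) w"
      unfolding free_algebra_def monoid.simps partial_object.simps ring.simps
      by (rule finsum_addf) (auto simp: c)
    finally show "((f \<oplus>\<^bsub>free_algebra R I\<^esub> g) \<otimes>\<^bsub>free_algebra R I\<^esub> h) w = (f \<otimes>\<^bsub>free_algebra R I\<^esub> h \<oplus>\<^bsub>free_algebra R I\<^esub> g \<otimes>\<^bsub>free_algebra R I\<^esub> h) w" .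
  qed
  show "h \<otimes>\<^bsub>free_algebra R I\<^esub> (f \<oplus>\<^bsub>free_algebra R I\<^esub> g) = h \<otimes>\<^bsub>free_algebra R I\<^esub> f \<oplus>\<^bsub>free_algebra R I\<^esub> h \<otimes>\<^bsub>free_algebra R I\<^esub> g"
  proof
    fix w
    have "(h \<otimes>\<^bsub>free_algebra R I\<^esub> (f \<oplus>\<^bsub>free_algebra R I\<^esub> g)) w = (\<Oplus>p\<in>{(u, v). u @ v = w}. h (fst p) \<otimes> f (snd p) \<oplus> h (fst p) \<otimes> g (snd p))"
      unfolding free_algebra_def monoid.simps partial_object.simps ring.simps
      by (rule finsum_cong') (auto simp: c r_distr)
    also have "\<dots> = (h \<otimes>\<^bsub>free_algebra R I\<^esub> f \<oplus>\<^bsub>free_algebra R I\<^esub> h \<otimes>\<^bsub>free_algebra R I\<^esub> g) w"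
      unfolding free_algebra_def monoid.simps partial_object.simps ring.simps
      by (rule finsum_addf) (auto simp: c)
    finally show "(h \<otimes>\<^bsub>free_algebra R I\<^esub> (f \<oplus>\<^bsub>free_algebra R I\<^esub> g)) w = (h \<otimes>\<^bsub>free_algebra R I\<^esub> f \<oplus>\<^bsub>free_algebra R I\<^esub> h \<otimes>\<^bsub>free_algebra R I\<^esub> g) w" .
  qed
qed

lemma free_algebra_module: "module R (free_algebra R I)"
proof (rule moduleI)
  show "cring R" by (rule is_cring)
  show "abelian_group (free_algebra R I)" using free_algebra_ring by (rule ring.is_abelian_group)
  show "\<one> \<odot>\<^bsub>free_algebra R I\<^esub> f = f" if "f \<in> carrier (free_algebra R I)" for f
    using free_algebra_carrierD(1)[OF that] by (auto simp: free_algebra_def)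
  fix a f assume a: "a \<in> carrier R" and A: "f \<in> carrier (free_algebra R I)"
  note c = a free_algebra_carrierD(1)[OF A]
  show "a \<odot>\<^bsub>free_algebra R I\<^esub> f \<in> carrier (free_algebra R I)" using A a by (rule free_algebra_smult_closed)
  show "(a \<oplus> b) \<odot>\<^bsub>free_algebra R I\<^esub> f = a \<odot>\<^bsub>free_algebra R I\<^esub> f \<oplus>\<^bsub>free_algebra R I\<^esub> b \<odot>\<^bsub>free_algebra R I\<^esub> f"
    "(a \<otimes> b) \<odot>\<^bsub>free_algebra R I\<^esub> f = a \<odot>\<^bsub>free_algebra R I\<^esub> (b \<odot>\<^bsub>free_algebra R I\<^esub> f)" if "b \<in> carrier R" for b
    using that by (auto simp: free_algebra_def c l_distr m_assoc)
  show "a \<odot>\<^bsub>free_algebra R I\<^esub> (f \<oplus>\<^bsub>free_algebra R I\<^esub> g) = a \<odot>\<^bsub>free_algebra R I\<^esub> f \<oplus>\<^bsub>free_algebra R I\<^esub> a \<odot>\<^bsub>free_algebra R I\<^esub> g"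
    if "g \<in> carrier (free_algebra R I)" for g
    using free_algebra_carrierD(1)[OF that] by (auto simp: free_algebra_def c r_distr)
qed

lemma free_algebra_smult_mult:
  assumes a: "a \<in> carrier R" and f: "f \<in> carrier (free_algebra R I)" and g: "g \<in> carrier (free_algebra R I)"
  shows "(a \<odot>\<^bsub>free_algebra R I\<^esub> f) \<otimes>\<^bsub>free_algebra R I\<^esub> g = a \<odot>\<^bsub>free_algebra R I\<^esub> (f \<otimes>\<^bsub>free_algebra R I\<^esub> g)"
proof
  fix w
  note c = a free_algebra_carrierD(1)[OF f] free_algebra_carrierD(1)[OF g]
  have "((a \<odot>\<^bsub>free_algebra R I\<^esub> f) \<otimes>\<^bsub>free_algebra R I\<^esub> g) w = (\<Oplus>p\<in>{(u, v). u @ v = w}. a \<otimes> (f (fst p) \<otimes> g (snd p)))"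
    unfolding free_algebra_def monoid.simps partial_object.simps module.simps
    by (rule finsum_cong') (auto simp: c m_assoc)
  also have "\<dots> = (a \<odot>\<^bsub>free_algebra R I\<^esub> (f \<otimes>\<^bsub>free_algebra R I\<^esub> g)) w"
    unfolding free_algebra_def monoid.simps partial_object.simps module.simps
    by (rule finsum_rdistr[symmetric]) (auto simp: c finite_splits)
  finally show "((a \<odot>\<^bsub>free_algebra R I\<^esub> f) \<otimes>\<^bsub>free_algebra R I\<^esub> g) w = (a \<odot>\<^bsub>free_algebra R I\<^esub> (f \<otimes>\<^bsub>free_algebra R I\<^esub> g)) w" .
qed

lemma word_monom_closed: "w \<in> lists I \<Longrightarrow> word_monom R w \<in> carrier (free_algebra R I)"
  by (auto simp: word_monom_def free_algebra_def)

lemma word_monom_mult: "word_monom R u \<otimes>\<^bsub>free_algebra R I\<^esub> word_monom R v = word_monom R (u @ v)"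
proof
  fix w
  have "(word_monom R u \<otimes>\<^bsub>free_algebra R I\<^esub> word_monom R v) w
      = (\<Oplus>p\<in>{(x, y). x @ y = w}. if (u, v) = p then \<one> else \<zero>)"
    unfolding free_algebra_def monoid.simps partial_object.simps word_monom_def
    by (rule finsum_cong') auto
  also have "\<dots> = word_monom R (u @ v) w"
  proof (cases "u @ v = w")
    case True
    then show ?thesis
      using add.finprod_singleton[of "(u, v)" "{(x, y). x @ y = w}" "\<lambda>_. \<one>"]
      by (simp add: finite_splits word_monom_def Pi_def)
  next
    case False
    then have "(\<Oplus>p\<in>{(x, y). x @ y = w}. if (u, v) = p then \<one> else \<zero>)
        = (\<Oplus>p\<in>{(x, y). x @ y = w}. \<zero>)"
      by (intro finsum_cong') auto
    with False show ?thesis by (auto simp: word_monom_def)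
  qed
  finally show "(word_monom R u \<otimes>\<^bsub>free_algebra R I\<^esub> word_monom R v) w = word_monom R (u @ v) w" .
qed

end

lemma set_alternating: "set (alternating a b n) \<subseteq> {a, b}"
  by (induction n arbitrary: a b) auto

lemma length_alternating: "length (alternating a b n) = n"
  by (induction n arbitrary: a b) auto

context
  fixes K (structure) and A (structure) and N
  assumes K: "cring K" and N: "ideal N A" and M: "module K A"
    and sm: "\<And>c x y. c \<in> carrier K \<Longrightarrow> x \<in> carrier A \<Longrightarrow> y \<in> carrier A \<Longrightarrow>
      (c \<odot>\<^bsub>A\<^esub> x) \<otimes>\<^bsub>A\<^esub> y = c \<odot>\<^bsub>A\<^esub> (x \<otimes>\<^bsub>A\<^esub> y)"
begin

interpretation K: cring K by (rule K)
interpretation N: ideal N A by (rule N)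
interpretation M: module K A by (rule M)

lemma ideal_smult: 
  assumes "c \<in> carrier K" "x \<in> N"
  shows "c \<odot>\<^bsub>A\<^esub> x \<in> N"
proof -
  have x: "x \<in> carrier A" using assms(2) by (rule N.Icarr)
  have "c \<odot>\<^bsub>A\<^esub> x = (c \<odot>\<^bsub>A\<^esub> \<one>\<^bsub>A\<^esub>) \<otimes>\<^bsub>A\<^esub> x"
    using sm[of c "\<one>\<^bsub>A\<^esub>" x] assms x by simp
  then show ?thesis using assms N.I_l_closed by simp
qed

lemma quotient_algebra_smult:
  assumes c: "c \<in> carrier K" and x: "x \<in> carrier A"
  shows "c \<odot>\<^bsub>quotient_algebra A N\<^esub> (N +>\<^bsub>A\<^esub> x) = N +>\<^bsub>A\<^esub> (c \<odot>\<^bsub>A\<^esub> x)"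
proof -
  have *: "N +>\<^bsub>A\<^esub> (c \<odot>\<^bsub>A\<^esub> y) = N +>\<^bsub>A\<^esub> (c \<odot>\<^bsub>A\<^esub> x)" if y: "y \<in> N +>\<^bsub>A\<^esub> x" for y
  proof -
    obtain h where h: "h \<in> N" "y = h \<oplus>\<^bsub>A\<^esub> x"
      using y unfolding a_r_coset_def' by blast
    have hc: "h \<in> carrier A" using h(1) by (rule N.Icarr)
    have "c \<odot>\<^bsub>A\<^esub> y = c \<odot>\<^bsub>A\<^esub> h \<oplus>\<^bsub>A\<^esub> c \<odot>\<^bsub>A\<^esub> x"
      using h hc c x by (simp add: M.smult_r_distr)
    then have "c \<odot>\<^bsub>A\<^esub> y \<in> N +>\<^bsub>A\<^esub> (c \<odot>\<^bsub>A\<^esub> x)"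
      using ideal_smult[OF c h(1)] unfolding a_r_coset_def' by blast
    then show ?thesis
      by (rule N.a_repr_independence'[symmetric]) (use c x in simp)
  qed
  have "x \<in> N +>\<^bsub>A\<^esub> x" using x by (rule N.a_rcos_self)
  then have "(\<Union>y\<in>N +>\<^bsub>A\<^esub> x. N +>\<^bsub>A\<^esub> (c \<odot>\<^bsub>A\<^esub> y)) = N +>\<^bsub>A\<^esub> (c \<odot>\<^bsub>A\<^esub> x)"
    using * by blast
  then show ?thesis by (simp add: quotient_algebra_def)
qed

lemma quotient_algebra_ring: "ring (quotient_algebra A N)"
proof -
  interpret Q: ring "A Quot N" by (rule N.quotient_is_ring)
  show ?thesis
  proof (rule ringI)
    show "abelian_group (quotient_algebra A N)"
      by (rule abelian_groupI) (auto simp: quotient_algebra_def Q.a_ac intro: Q.l_neg)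
    show "Group.monoid (quotient_algebra A N)"
      by (rule monoidI) (auto simp: quotient_algebra_def Q.m_assoc)
  qed (auto simp: quotient_algebra_def Q.l_distr Q.r_distr)
qed

lemma quotient_algebra_module: "module K (quotient_algebra A N)"
proof -
  interpret Q: ring "quotient_algebra A N" by (rule quotient_algebra_ring)
  have carr: "\<exists>x\<in>carrier A. X = N +>\<^bsub>A\<^esub> x" if "X \<in> carrier (quotient_algebra A N)" for X
    using that by (auto simp: quotient_algebra_def FactRing_def A_RCOSETS_def')
  have carrI: "N +>\<^bsub>A\<^esub> x \<in> carrier (quotient_algebra A N)" if "x \<in> carrier A" for x
    using that by (auto simp: quotient_algebra_def FactRing_def A_RCOSETS_def')
  have add: "(N +>\<^bsub>A\<^esub> x) \<oplus>\<^bsub>quotient_algebra A N\<^esub> (N +>\<^bsub>A\<^esub> y) = N +>\<^bsub>A\<^esub> (x \<oplus>\<^bsub>A\<^esub> y)"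
    if "x \<in> carrier A" "y \<in> carrier A" for x y
    using that by (simp add: quotient_algebra_def FactRing_def N.a_rcos_sum)
  show ?thesis
    by (rule moduleI)
      (auto dest!: carr simp: K quotient_algebra_smult add carrI Q.is_abelian_group
        M.smult_l_distr M.smult_r_distr M.smult_assoc1)
qed

end

lemma nil_hecke_relators_closed:
  assumes K: "cring K" and J0: "J0 \<subseteq> braid_pairs I m"
  shows "nil_hecke_relators K I m d J0 \<subseteq> carrier (free_algebra K I)"
proof -
  interpret K: cring K by (rule K)
  interpret F: ring "free_algebra K I" by (rule K.free_algebra_ring)
  have alt: "alternating a b n \<in> lists I" if "{a, b} \<in> braid_pairs I m" for a b n
    using that set_alternating[of a b n] by (auto simp: braid_pairs_def doubleton_eq_iff)
  then have alt': "alternating b a n \<in> lists I" if "{a, b} \<in> braid_pairs I m" for a b n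
    using that by (simp only: insert_commute)
  have rep: "replicate n i \<in> lists I" if "i \<in> I" for n i
    using that by auto
  show ?thesis
  proof
    fix x assume "x \<in> nil_hecke_relators K I m d J0"
    then consider i where "i \<in> I" "x = word_monom K (replicate (d i) i)"
      | a b where "{a, b} \<in> J0"
          "x = word_monom K (alternating a b (the_enat (m a b))) \<ominus>\<^bsub>free_algebra K I\<^esub>
               word_monom K (alternating b a (the_enat (m a b)))"
      | a b where "{a, b} \<in> braid_pairs I m"
          "x = word_monom K (alternating a b (the_enat (m a b)))"
      unfolding nil_hecke_relators_def by blast
    then show "x \<in> carrier (free_algebra K I)"
    proof cases
      case 1
      then show ?thesis using rep K.word_monom_closed by metis
    next
      case 2
      then have "{a, b} \<in> braid_pairs I m" using J0 by auto
      with 2(2) show ?thesis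
        using alt alt' K.word_monom_closed F.minus_closed by metis
    next
      case 3
      then show ?thesis using alt K.word_monom_closed by metis
    qed
  qed
qed

theorem nil_hecke_ring:
  assumes "cring K" "J0 \<subseteq> braid_pairs I m"
  shows "ring (nil_hecke K I m d J0)"
  unfolding nil_hecke_def
  by (rule quotient_algebra_ring[OF assms(1) ring.genideal_ideal cring.free_algebra_module])
    (use assms in \<open>simp_all add: cring.free_algebra_ring cring.free_algebra_smult_mult nil_hecke_relators_closed\<close>)

theorem nil_hecke_module:
  assumes "cring K" "J0 \<subseteq> braid_pairs I m"
  shows "module K (nil_hecke K I m d J0)"
  unfolding nil_hecke_def
  by (rule quotient_algebra_module[OF assms(1) ring.genideal_ideal cring.free_algebra_module])
    (use assms in \<open>simp_all add: cring.free_algebra_ring cring.free_algebra_smult_mult nil_hecke_relators_closed\<close>)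

end

theory Submission
  imports Defs "HOL-Library.Sublist"
begin

text \<open>
  No pair of nodes has a braid relation of length below two, so every relator of the algebra is a
  single word: \<open>i\<close> repeated \<open>d i\<close> times, or an alternating word in \<open>a, b\<close> of length \<open>m a b\<close>. The
  quotient of a free algebra by words has a basis: the \<^emph>\<open>reduced\<close> words, those without a relator as a factor.
  Hence the algebra is free of rank the number of reduced words if that number is finite, and is not
  finitely generated otherwise (\<open>free_of_rank_card\<close>, \<open>finite_if_fin_gen\<close>); what remains is to count
  reduced words.

  Since a pair with \<open>m a b = 2\<close> kills \<open>ab\<close>, a reduced word is a walk in the Coxeter graph that may
  also pause. It can pause only at a node with \<open>d i \<ge> 3\<close> and turn back, as in \<open>aba\<close>, only along a
  multiple edge. Call these nodes and edges \<^emph>\<open>gadgets\<close>. All non-backtracking walks are reduced.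

  \<^emph>\<open>Infinitely many reduced words.\<close> A walk may run around a cycle for ever, back and forth along an
  edge with \<open>m a b = \<infinity>\<close>, or back and forth between two gadgets, reversing its direction at each of
  them (\<open>infinite_red_if_cycle\<close>, \<open>infinite_red_if_infinite_edge\<close>, \<open>infinite_red_if_two_ends\<close>). If none
  of this is possible, the graph is a tree with at most one gadget, and one of the two cases of the
  classification holds.

  \<^emph>\<open>Counting.\<close> In a tree with \<open>n\<close> nodes a non-backtracking walk is determined by its end points,
  and there is one for each pair of end points; with the empty word this gives \<open>1 + n\<^sup>2\<close> words. Let the
  \<^emph>\<open>core\<close> be the node or the two ends of the edge that forms the only gadget, or any node if there
  is no gadget. A walk that has left the core cannot turn, so in a tree it cannot come back.
  Therefore any other reduced word is
  \<open>u r v\<close>, where \<open>r\<close> is a reduced word in core letters that pauses or turns, \<open>u\<close> walks to the first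
  letter of \<open>r\<close>, \<open>v\<close> walks away from its last letter, and both stay outside the core (\<open>card_red\<close>).
  For a core \<open>{i}\<close> there are \<open>d i - 2\<close> words \<open>r\<close>, each with \<open>n\<close> choices for \<open>u\<close> and for \<open>v\<close>. For
  an edge whose removal leaves trees with \<open>a\<close> and \<open>b\<close> nodes there are two alternating words \<open>r\<close>
  of each length \<open>3, ..., M - 1\<close>; together they contribute \<open>a\<^sup>2 + b\<^sup>2\<close> for odd length and \<open>2 a b\<close> for
  even length.
\<close>

section \<open>Quotients of free algebras by words\<close>

definition reduced_words :: "'i set \<Rightarrow> 'i list set \<Rightarrow> 'i list set" where
  "reduced_words I F = {w \<in> lists I. \<forall>f\<in>F. \<not> sublist f w}"

lemma reduced_words_sublist:
  assumes "w \<in> reduced_words I F" "sublist v w"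
  shows "v \<in> reduced_words I F"
  using assms set_mono_sublist[OF assms(2)] sublist_order.order_trans
  by (fastforce simp: reduced_words_def)

context cring
begin

lemma free_algebra_apply:
  "\<zero>\<^bsub>free_algebra R I\<^esub> w = \<zero>"
  "(f \<oplus>\<^bsub>free_algebra R I\<^esub> g) w = f w \<oplus> g w"
  "(c \<odot>\<^bsub>free_algebra R I\<^esub> f) w = c \<otimes> f w"
  by (simp_all add: free_algebra_def)

lemma free_algebra_uminus_apply:
  assumes "f \<in> carrier (free_algebra R I)"
  shows "(\<ominus>\<^bsub>free_algebra R I\<^esub> f) w = \<ominus> f w"
proof -
  interpret M: module R "free_algebra R I" by (rule free_algebra_module)
  have "(\<ominus>\<^bsub>free_algebra R I\<^esub> f) w = (\<ominus> \<one> \<odot>\<^bsub>free_algebra R I\<^esub> f) w"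
    by (simp only: M.smult_minus_1[OF assms])
  also have "\<dots> = \<ominus> f w"
    using free_algebra_carrierD(1)[OF assms] by (simp add: free_algebra_apply l_minus)
  finally show ?thesis .
qed

lemma free_algebra_mult_apply_zero:
  assumes "f \<in> carrier (free_algebra R I)" "g \<in> carrier (free_algebra R I)"
    and "\<And>u v. w = u @ v \<Longrightarrow> f u = \<zero> \<or> g v = \<zero>"
  shows "(f \<otimes>\<^bsub>free_algebra R I\<^esub> g) w = \<zero>"
proof -
  have "(f \<otimes>\<^bsub>free_algebra R I\<^esub> g) w = (\<Oplus>p\<in>{(u, v). u @ v = w}. \<zero>)"
    unfolding free_algebra_def monoid.simps partial_object.simps
  proof (rule finsum_cong')
    fix p assume "p \<in> {(u, v). u @ v = w}"
    then show "f (fst p) \<otimes> g (snd p) = \<zero>"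
      using assms(3)[of "fst p" "snd p"] free_algebra_carrierD(1)[OF assms(1)]
        free_algebra_carrierD(1)[OF assms(2)] by auto
  qed auto
  then show ?thesis by simp
qed

end

lemma fin_gen_if_free:
  "free_of_rank K M n \<Longrightarrow> fin_gen_module K M"
  unfolding free_of_rank_def fin_gen_module_def by blast

locale monomial_algebra = cring R for R (structure) +
  fixes I :: "'i set" and F :: "'i list set"
  assumes one_not_zero: "\<one> \<noteq> \<zero>"
    and F_lists: "F \<subseteq> lists I"
begin

abbreviation A where "A \<equiv> free_algebra R I"

definition N where "N = genideal A (word_monom R ` F)"

abbreviation Q where "Q \<equiv> quotient_algebra A N"

sublocale A: module R A by (rule free_algebra_module)
sublocale A: ring A by (rule free_algebra_ring)

text \<open>
  A factor of a reduced word is reduced. So if \<open>f\<close> vanishes on all reduced words, each summand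
  \<open>g u \<cdot> f v\<close> of the coefficient of a reduced word \<open>u @ v\<close> in \<open>g f\<close> is zero.
\<close>
lemma vanishing_ideal: "ideal {f \<in> carrier A. \<forall>w\<in>reduced_words I F. f w = \<zero>} A"
proof (rule idealI)
  show "ring A" by (rule free_algebra_ring)
  show "subgroup {f \<in> carrier A. \<forall>w\<in>reduced_words I F. f w = \<zero>} (add_monoid A)"
    by (rule A.add.subgroupI) (auto simp: free_algebra_apply free_algebra_uminus_apply
          simp flip: a_inv_def intro: exI[of _ "\<zero>\<^bsub>A\<^esub>"])
  show "g \<otimes>\<^bsub>A\<^esub> f \<in> {f \<in> carrier A. \<forall>w\<in>reduced_words I F. f w = \<zero>}"
    "f \<otimes>\<^bsub>A\<^esub> g \<in> {f \<in> carrier A. \<forall>w\<in>reduced_words I F. f w = \<zero>}"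
    if f: "f \<in> {f \<in> carrier A. \<forall>w\<in>reduced_words I F. f w = \<zero>}" and g: "g \<in> carrier A" for f g
    using f g by (auto intro!: free_algebra_mult_apply_zero dest: reduced_words_sublist)
qed

lemma monom_closed: "w \<in> lists I \<Longrightarrow> word_monom R w \<in> carrier A"
  by (rule word_monom_closed)

lemma N_ideal: "ideal N A"
  unfolding N_def using F_lists monom_closed by (intro A.genideal_ideal) blast

sublocale N: ideal N A by (rule N_ideal)

lemma N_smult: "c \<in> carrier R \<Longrightarrow> f \<in> N \<Longrightarrow> c \<odot>\<^bsub>A\<^esub> f \<in> N"
  by (rule ideal_smult[OF is_cring N_ideal free_algebra_module])
    (auto simp: free_algebra_smult_mult)

lemma monom_in_N:
  assumes "w \<in> lists I" "w \<notin> reduced_words I F"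
  shows "word_monom R w \<in> N"
proof -
  obtain ps f ss where f: "f \<in> F" and w: "w = ps @ f @ ss"
    using assms by (auto simp: reduced_words_def sublist_def)
  have "word_monom R f \<in> N"
    unfolding N_def using f F_lists monom_closed by (blast intro: A.genideal_self[THEN subsetD])
  then have "word_monom R ps \<otimes>\<^bsub>A\<^esub> (word_monom R f \<otimes>\<^bsub>A\<^esub> word_monom R ss) \<in> N"
    using assms(1) w by (intro N.I_l_closed N.I_r_closed monom_closed) auto
  then show ?thesis by (simp add: word_monom_mult w)
qed

text \<open>
  Peeling off one word of the support at a time writes \<open>f\<close> as a finite combination of non-reduced
  words, and these are multiples of relators. The support is bounded by a set \<open>S\<close> for the sake of the induction.
\<close>
lemma in_N_if_support:
  assumes "finite S" "f \<in> carrier A" "{w. f w \<noteq> \<zero>} \<subseteq> S" "S \<subseteq> lists I - reduced_words I F"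
  shows "f \<in> N"
  using assms
proof (induction S arbitrary: f rule: finite_induct)
  case empty
  then have "f = \<zero>\<^bsub>A\<^esub>" by (auto simp: free_algebra_apply)
  then show ?case by simp
next
  case (insert w S)
  note c = free_algebra_carrierD[OF insert.prems(1)]
  let ?g = "\<lambda>v. if v = w then \<zero> else f v"
  have fin: "finite {v. ?g v \<noteq> \<zero>}"
    by (rule finite_subset[OF _ c(2)]) auto
  have g: "?g \<in> carrier A"
    using c fin by (auto simp: free_algebra_def simp del: in_lists_conv_set split: if_splits)
  have "?g \<in> N"
    using insert.prems by (intro insert.IH g) auto
  moreover have "f w \<odot>\<^bsub>A\<^esub> word_monom R w \<in> N"
    using insert.prems c by (auto intro!: N_smult monom_in_N simp del: in_lists_conv_set)
  moreover have "f = f w \<odot>\<^bsub>A\<^esub> word_monom R w \<oplus>\<^bsub>A\<^esub> ?g"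
    using c by (auto simp: free_algebra_apply word_monom_def)
  ultimately show ?case using N.a_closed by metis
qed

text \<open>
  Membership in the ideal thus becomes a condition on coefficients; everything that follows about
  the quotient rests on this.
\<close>
lemma N_eq: "N = {f \<in> carrier A. \<forall>w\<in>reduced_words I F. f w = \<zero>}"
proof
  show "N \<subseteq> {f \<in> carrier A. \<forall>w\<in>reduced_words I F. f w = \<zero>}"
    unfolding N_def
  proof (rule A.genideal_minimal[OF vanishing_ideal])
    show "word_monom R ` F \<subseteq> {f \<in> carrier A. \<forall>w\<in>reduced_words I F. f w = \<zero>}"
    proof
      fix f assume "f \<in> word_monom R ` F"
      then obtain v where v: "v \<in> F" "f = word_monom R v" by blast
      moreover have "v \<in> lists I" using v F_lists by blast
      moreover have "v \<notin> reduced_words I F" using v by (auto simp: reduced_words_def)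
      ultimately show "f \<in> {f \<in> carrier A. \<forall>w\<in>reduced_words I F. f w = \<zero>}"
        using monom_closed by (auto simp: word_monom_def)
    qed
  qed
  show "{f \<in> carrier A. \<forall>w\<in>reduced_words I F. f w = \<zero>} \<subseteq> N"
  proof
    fix f assume f: "f \<in> {f \<in> carrier A. \<forall>w\<in>reduced_words I F. f w = \<zero>}"
    then have "f \<in> carrier A" by simp
    note c = free_algebra_carrierD[OF this]
    show "f \<in> N" using f c by (intro in_N_if_support[of "{w. f w \<noteq> \<zero>}"]) auto
  qed
qed

lemma Q_module: "module R Q"
  by (rule quotient_algebra_module[OF is_cring N_ideal free_algebra_module])
    (rule free_algebra_smult_mult)

sublocale Q: module R Q by (rule Q_module)

lemma Q_smult: "c \<in> carrier R \<Longrightarrow> x \<in> carrier A \<Longrightarrow> c \<odot>\<^bsub>Q\<^esub> (N +>\<^bsub>A\<^esub> x) = N +>\<^bsub>A\<^esub> (c \<odot>\<^bsub>A\<^esub> x)"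
  by (rule quotient_algebra_smult[OF is_cring N_ideal free_algebra_module])
    (rule free_algebra_smult_mult)

lemma Q_carrierE:
  assumes "X \<in> carrier Q"
  obtains x where "x \<in> carrier A" "X = N +>\<^bsub>A\<^esub> x"
  using assms by (auto simp: quotient_algebra_def FactRing_def A_RCOSETS_def')

lemma Q_carrierI: "x \<in> carrier A \<Longrightarrow> N +>\<^bsub>A\<^esub> x \<in> carrier Q"
  by (auto simp: quotient_algebra_def FactRing_def A_RCOSETS_def')

lemma Q_add:
  "x \<in> carrier A \<Longrightarrow> y \<in> carrier A \<Longrightarrow> (N +>\<^bsub>A\<^esub> x) \<oplus>\<^bsub>Q\<^esub> (N +>\<^bsub>A\<^esub> y) = N +>\<^bsub>A\<^esub> (x \<oplus>\<^bsub>A\<^esub> y)"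
  by (simp add: quotient_algebra_def FactRing_def N.a_rcos_sum)

lemma Q_zero: "\<zero>\<^bsub>Q\<^esub> = N +>\<^bsub>A\<^esub> \<zero>\<^bsub>A\<^esub>"
  by (force simp: quotient_algebra_def FactRing_def a_r_coset_def' dest: N.Icarr)

text \<open>
  By \<open>N_eq\<close> all members of a coset agree on the reduced words, so for reduced \<open>w\<close> the choice of a
  representative is immaterial.
\<close>
definition coeff :: "'i list \<Rightarrow> ('i list \<Rightarrow> 'a) set \<Rightarrow> 'a" where
  "coeff w X = (SOME f. f \<in> X) w"

lemma coeff_coset:
  assumes "w \<in> reduced_words I F" "x \<in> carrier A"
  shows "coeff w (N +>\<^bsub>A\<^esub> x) = x w"
proof -
  define y where "y = (SOME f. f \<in> N +>\<^bsub>A\<^esub> x)"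
  have "x \<in> N +>\<^bsub>A\<^esub> x" using assms by (intro N.a_rcos_self)
  then have "y \<in> N +>\<^bsub>A\<^esub> x" unfolding y_def by (rule someI[of "\<lambda>f. f \<in> N +>\<^bsub>A\<^esub> x"])
  then obtain h where h: "h \<in> N" and y: "y = h \<oplus>\<^bsub>A\<^esub> x" unfolding a_r_coset_def' by blast
  have "h w = \<zero>" using h assms(1) unfolding N_eq by blast
  then have "y w = x w"
    using free_algebra_carrierD(1)[OF assms(2)] unfolding y free_algebra_apply by simp
  then show ?thesis by (simp add: coeff_def y_def)
qed

lemma coeff_simps:
  assumes "w \<in> reduced_words I F"
  shows "X \<in> carrier Q \<Longrightarrow> coeff w X \<in> carrier R"
    and "X \<in> carrier Q \<Longrightarrow> Y \<in> carrier Q \<Longrightarrow> coeff w (X \<oplus>\<^bsub>Q\<^esub> Y) = coeff w X \<oplus> coeff w Y"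
    and "X \<in> carrier Q \<Longrightarrow> c \<in> carrier R \<Longrightarrow> coeff w (c \<odot>\<^bsub>Q\<^esub> X) = c \<otimes> coeff w X"
    and "coeff w \<zero>\<^bsub>Q\<^esub> = \<zero>"
  using assms free_algebra_carrierD(1)
  by (auto elim!: Q_carrierE simp: coeff_coset Q_add Q_smult Q_zero free_algebra_apply)

text \<open>
  The coefficients at reduced words are coordinates of the quotient. Linear independence, spanning and
  the finiteness argument below all reduce to computing them.
\<close>
lemma Q_eqI:
  assumes X: "X \<in> carrier Q" and Y: "Y \<in> carrier Q"
    and eq: "\<And>w. w \<in> reduced_words I F \<Longrightarrow> coeff w X = coeff w Y"
  shows "X = Y"
proof -
  obtain x y where x: "x \<in> carrier A" "X = N +>\<^bsub>A\<^esub> x" and y: "y \<in> carrier A" "Y = N +>\<^bsub>A\<^esub> y"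
    using X Y by (metis Q_carrierE)
  have "x w \<oplus> \<ominus> y w = \<zero>" if "w \<in> reduced_words I F" for w
    using eq[OF that] that x y free_algebra_carrierD(1)[OF y(1)] by (simp add: coeff_coset r_neg)
  then have "x \<ominus>\<^bsub>A\<^esub> y \<in> N"
    unfolding N_eq mem_Collect_eq using A.minus_closed[OF x(1) y(1)]
    by (simp add: a_minus_def free_algebra_apply free_algebra_uminus_apply[OF y(1)])
  then show ?thesis
    using x y N.a_rcos_module_minus[OF free_algebra_ring] N.a_repr_independence' by metis
qed

lemma coeff_lincomb:
  assumes w: "w \<in> reduced_words I F" and "finite S" "S \<subseteq> carrier Q" "a \<in> S \<rightarrow> carrier R"
  shows "coeff w (Q.lincomb a S) = (\<Oplus>v\<in>S. a v \<otimes> coeff w v)"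
  using assms(2-4)
proof (induction S rule: finite_induct)
  case empty
  then show ?case by (simp add: Q.lincomb_def coeff_simps[OF w])
next
  case (insert v S)
  have c: "(\<lambda>v. a v \<odot>\<^bsub>Q\<^esub> v) \<in> S \<rightarrow> carrier Q" using insert.prems by blast
  have "Q.lincomb a (insert v S) = a v \<odot>\<^bsub>Q\<^esub> v \<oplus>\<^bsub>Q\<^esub> Q.lincomb a S"
    unfolding Q.lincomb_def using insert c by (subst Q.finsum_insert) auto
  moreover have "Q.lincomb a S \<in> carrier Q" using insert by blast
  moreover have "(\<Oplus>v\<in>insert v S. a v \<otimes> coeff w v) = a v \<otimes> coeff w v \<oplus> (\<Oplus>v\<in>S. a v \<otimes> coeff w v)"
    using insert by (subst finsum_insert) (auto intro!: coeff_simps[OF w] m_closed)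
  ultimately show ?case using insert by (simp add: coeff_simps[OF w])
qed

definition basis_elem :: "'i list \<Rightarrow> ('i list \<Rightarrow> 'a) set" where
  "basis_elem w = N +>\<^bsub>A\<^esub> word_monom R w"

lemma reduced_lists: "w \<in> reduced_words I F \<Longrightarrow> w \<in> lists I"
  by (simp add: reduced_words_def)

lemma basis_elem_closed: "w \<in> reduced_words I F \<Longrightarrow> basis_elem w \<in> carrier Q"
  unfolding basis_elem_def by (intro Q_carrierI monom_closed reduced_lists)

lemma coeff_basis_elem:
  "v \<in> reduced_words I F \<Longrightarrow> w \<in> reduced_words I F \<Longrightarrow> coeff v (basis_elem w) = (if v = w then \<one> else \<zero>)"
  unfolding basis_elem_def
  by (subst coeff_coset[OF _ monom_closed[OF reduced_lists]]) (simp_all add: word_monom_def)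

lemma inj_on_basis_elem: "inj_on basis_elem (reduced_words I F)"
  by (rule inj_onI) (metis coeff_basis_elem one_not_zero)

lemma free_of_rank_card:
  assumes fin: "finite (reduced_words I F)"
  shows "free_of_rank R Q (card (reduced_words I F))"
proof -
  let ?W = "reduced_words I F"
  have sub: "basis_elem ` ?W \<subseteq> carrier Q" using basis_elem_closed by blast
  have coef: "coeff w (Q.lincomb a (basis_elem ` ?W)) = a (basis_elem w)"
    if w: "w \<in> ?W" and a: "a \<in> basis_elem ` ?W \<rightarrow> carrier R" for a w
  proof -
    have "coeff w (Q.lincomb a (basis_elem ` ?W)) = (\<Oplus>X\<in>basis_elem ` ?W. a X \<otimes> coeff w X)"
      using w a fin sub by (intro coeff_lincomb) auto
    also have "\<dots> = (\<Oplus>X\<in>basis_elem ` ?W. if basis_elem w = X then a X else \<zero>)"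
      using w a by (intro finsum_cong') (auto simp: coeff_basis_elem inj_on_eq_iff[OF inj_on_basis_elem] Pi_iff split: if_splits)
    also have "\<dots> = a (basis_elem w)"
      using w a fin by (intro finsum_singleton) auto
    finally show ?thesis .
  qed
  have "Q.lin_indpt (basis_elem ` ?W)"
  proof (rule Q.finite_lin_indpt2)
    show "\<forall>v\<in>basis_elem ` ?W. a v = \<zero>" if "a \<in> basis_elem ` ?W \<rightarrow> carrier R" "Q.lincomb a (basis_elem ` ?W) = \<zero>\<^bsub>Q\<^esub>" for a
      using coef[OF _ that(1)] that(2) coeff_simps(4) by force
  qed (use fin sub in auto)
  moreover have "X \<in> Q.span (basis_elem ` ?W)" if X: "X \<in> carrier Q" for X
  proof -
    let ?a = "\<lambda>Y. coeff (inv_into ?W basis_elem Y) X"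
    have inv: "inv_into ?W basis_elem (basis_elem w) = w" if "w \<in> ?W" for w
      using inj_on_basis_elem that by (rule inv_into_f_f)
    have a: "?a \<in> basis_elem ` ?W \<rightarrow> carrier R" using X by (auto simp: inv intro: coeff_simps)
    have "X = Q.lincomb ?a (basis_elem ` ?W)"
      by (rule Q_eqI) (use X a sub in \<open>auto simp: coef[OF _ a] inv\<close>)
    then show ?thesis using a fin sub by (subst Q.finite_span) auto
  qed
  ultimately show ?thesis
    unfolding free_of_rank_def
    using Q_module fin sub card_image[OF inj_on_basis_elem] Q.span_is_subset2[OF sub]
    by (intro conjI exI[of _ "basis_elem ` ?W"]) auto
qed

text \<open>
  Finitely many generators involve only finitely many reduced words, and the coset of any further
  reduced word would have a coefficient \<open>\<one>\<close> that no combination of them can produce.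
\<close>
lemma finite_if_fin_gen:
  assumes "fin_gen_module R Q"
  shows "finite (reduced_words I F)"
proof -
  let ?W = "reduced_words I F"
  obtain S where S: "finite S" "S \<subseteq> carrier Q" "Q.span S = carrier Q"
    using assms by (auto simp: fin_gen_module_def)
  have supp: "finite {w \<in> ?W. coeff w X \<noteq> \<zero>}" if X: "X \<in> carrier Q" for X
  proof -
    obtain x where x: "x \<in> carrier A" "X = N +>\<^bsub>A\<^esub> x" using X by (rule Q_carrierE)
    show ?thesis
      by (rule finite_subset[OF _ free_algebra_carrierD(2)[OF x(1)]]) (auto simp: x coeff_coset)
  qed
  have "w \<in> (\<Union>X\<in>S. {w \<in> ?W. coeff w X \<noteq> \<zero>})" if w: "w \<in> ?W" for w
  proof (rule ccontr)
    assume "w \<notin> (\<Union>X\<in>S. {w \<in> ?W. coeff w X \<noteq> \<zero>})"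
    then have z: "coeff w X = \<zero>" if "X \<in> S" for X using that w by blast
    obtain a where a: "a \<in> S \<rightarrow> carrier R" "basis_elem w = Q.lincomb a S"
      using basis_elem_closed[OF w] Q.finite_span[OF S(1,2)] S(3) by auto
    have "coeff w (basis_elem w) = (\<Oplus>v\<in>S. a v \<otimes> coeff w v)"
      unfolding a(2) using w S a by (intro coeff_lincomb)
    also have "\<dots> = (\<Oplus>v\<in>S. \<zero>)" using a by (intro finsum_cong') (auto simp: z Pi_iff)
    finally show False using one_not_zero w by (simp add: coeff_basis_elem)
  qed
  then have "?W \<subseteq> (\<Union>X\<in>S. {w \<in> ?W. coeff w X \<noteq> \<zero>})" by (rule subsetI)
  then show ?thesis by (rule finite_subset) (use S(1,2) supp in blast)
qed

end

section \<open>Non-backtracking walks in graphs and trees\<close>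

locale simple_graph =
  fixes V :: "'v set" and E :: "'v set set"
  assumes edgeE: "e \<in> E \<Longrightarrow> \<exists>u v. u \<in> V \<and> v \<in> V \<and> u \<noteq> v \<and> e = {u, v}"
begin

lemma edge_in: "{u, v} \<in> E \<Longrightarrow> u \<in> V \<and> v \<in> V \<and> u \<noteq> v"
  using edgeE[of "{u, v}"] by (auto simp: doubleton_eq_iff)

text \<open>
  Non-backtracking walks: no step is immediately undone. The empty walk is included, since it
  corresponds to the unit of the algebra.
\<close>
definition nbw :: "'v list \<Rightarrow> bool" where
  "nbw w \<longleftrightarrow> set w \<subseteq> V \<and> (\<forall>i. Suc i < length w \<longrightarrow> {w ! i, w ! Suc i} \<in> E) \<and>
     (\<forall>i. Suc (Suc i) < length w \<longrightarrow> w ! i \<noteq> w ! Suc (Suc i))"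

lemma nbw_Nil [simp]: "nbw []"
  and nbw_single [simp]: "nbw [x] \<longleftrightarrow> x \<in> V"
  by (auto simp: nbw_def)

lemma nbw_edge: "nbw w \<Longrightarrow> Suc i < length w \<Longrightarrow> {w ! i, w ! Suc i} \<in> E"
  and nbw_no_turn: "nbw w \<Longrightarrow> Suc (Suc i) < length w \<Longrightarrow> w ! i \<noteq> w ! Suc (Suc i)"
  by (auto simp: nbw_def)

lemma nbw_sublist:
  assumes "nbw w" "sublist v w"
  shows "nbw v"
proof -
  obtain ps ss where w: "w = ps @ v @ ss" using assms(2) by (auto simp: sublist_def)
  have n: "w ! (length ps + i) = v ! i" if "i < length v" for i
    using that by (simp add: w nth_append)
  have "{v ! i, v ! Suc i} \<in> E" if "Suc i < length v" for i
  proof -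
    have "{w ! (length ps + i), w ! Suc (length ps + i)} \<in> E"
      using that by (intro nbw_edge[OF assms(1)]) (simp add: w)
    then show ?thesis using n[of i] n[of "Suc i"] that by simp
  qed
  moreover have "v ! i \<noteq> v ! Suc (Suc i)" if "Suc (Suc i) < length v" for i
  proof -
    have "w ! (length ps + i) \<noteq> w ! Suc (Suc (length ps + i))"
      using that by (intro nbw_no_turn[OF assms(1)]) (simp add: w)
    then show ?thesis using n[of i] n[of "Suc (Suc i)"] that by simp
  qed
  moreover have "set v \<subseteq> V" using assms(1) by (auto simp: nbw_def w)
  ultimately show ?thesis by (simp add: nbw_def)
qed

lemma nbw_rev [simp]: "nbw (rev w) \<longleftrightarrow> nbw w"
proof -
  have "nbw (rev w)" if w: "nbw w" for w
  proof -
    have "{rev w ! i, rev w ! Suc i} \<in> E" if "Suc i < length w" for i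
    proof -
      have "Suc (length w - Suc (Suc i)) = length w - Suc i" using that by simp
      moreover have "{w ! (length w - Suc (Suc i)), w ! Suc (length w - Suc (Suc i))} \<in> E"
        using that by (intro nbw_edge[OF w]) simp
      ultimately show ?thesis using that by (simp add: rev_nth insert_commute)
    qed
    moreover have "rev w ! i \<noteq> rev w ! Suc (Suc i)" if "Suc (Suc i) < length w" for i
    proof -
      have "Suc (Suc (length w - Suc (Suc (Suc i)))) = length w - Suc i" using that by simp
      moreover have "w ! (length w - Suc (Suc (Suc i))) \<noteq> w ! Suc (Suc (length w - Suc (Suc (Suc i))))"
        using that by (intro nbw_no_turn[OF w]) simp
      ultimately show ?thesis using that by (simp add: rev_nth)
    qed
    ultimately show ?thesis using w by (auto simp: nbw_def)
  qed
  from this[of w] this[of "rev w"] show ?thesis by auto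
qed

lemma nbw_glue:
  assumes u: "nbw (u @ [c])" and v: "nbw (c # v)" and uv: "u \<noteq> [] \<Longrightarrow> v \<noteq> [] \<Longrightarrow> last u \<noteq> hd v"
  shows "nbw (u @ c # v)"
proof -
  let ?w = "u @ c # v"
  have left: "?w ! i = (u @ [c]) ! i" if "i \<le> length u" for i using that by (auto simp: nth_append)
  have right: "?w ! i = (c # v) ! (i - length u)" if "length u \<le> i" for i
    using that by (auto simp: nth_append)
  have "{?w ! i, ?w ! Suc i} \<in> E" if "Suc i < length ?w" for i
  proof (cases "Suc i \<le> length u")
    case True
    then show ?thesis using nbw_edge[OF u, of i] left[of i] left[of "Suc i"] by simp
  next
    case False
    then show ?thesis
      using nbw_edge[OF v, of "i - length u"] right[of i] right[of "Suc i"] that by (simp add: Suc_diff_le)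
  qed
  moreover have "?w ! i \<noteq> ?w ! Suc (Suc i)" if "Suc (Suc i) < length ?w" for i
  proof -
    consider "Suc (Suc i) \<le> length u" | "length u \<le> i" | "Suc i = length u" by linarith
    then show ?thesis
    proof cases
      case 1
      then show ?thesis using nbw_no_turn[OF u, of i] left[of i] left[of "Suc (Suc i)"] by simp
    next
      case 2
      then have "Suc (Suc i) - length u = Suc (Suc (i - length u))" by linarith
      then show ?thesis using nbw_no_turn[OF v, of "i - length u"] right[of i] right[of "Suc (Suc i)"] 2 that by simp
    next
      case 3
      then have ne: "u \<noteq> []" "v \<noteq> []" using that by auto
      have "?w ! i = last u" using 3 ne by (auto simp: nth_append last_conv_nth simp flip: 3)
      moreover have "?w ! Suc (Suc i) = hd v" using 3 ne by (simp add: nth_append hd_conv_nth)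
      ultimately show ?thesis using uv ne by simp
    qed
  qed
  ultimately show ?thesis using u v by (auto simp: nbw_def)
qed

lemma nbw_Cons_Cons:
  "nbw (x # y # w) \<longleftrightarrow> {x, y} \<in> E \<and> nbw (y # w) \<and> (w \<noteq> [] \<longrightarrow> x \<noteq> hd w)"
proof
  assume a: "nbw (x # y # w)"
  have "nbw (y # w)" by (rule nbw_sublist[OF a]) (auto simp: sublist_Cons_right)
  moreover have "{x, y} \<in> E" using nbw_edge[OF a, of 0] by simp
  moreover have "w \<noteq> [] \<longrightarrow> x \<noteq> hd w"
    using nbw_no_turn[OF a, of 0] by (auto simp: hd_conv_nth)
  ultimately show "{x, y} \<in> E \<and> nbw (y # w) \<and> (w \<noteq> [] \<longrightarrow> x \<noteq> hd w)" by blast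
next
  assume a: "{x, y} \<in> E \<and> nbw (y # w) \<and> (w \<noteq> [] \<longrightarrow> x \<noteq> hd w)"
  then have "nbw ([x] @ [y])" using edge_in by (auto simp: nbw_def)
  from nbw_glue[OF this, of w] a show "nbw (x # y # w)" by auto
qed

text \<open>
  Between two visits of the same vertex that are as close as possible, the walk is a cycle: the two
  degenerate closed walks \<open>y y\<close> and \<open>y a y\<close> are a loop and a backtracking.
\<close>
lemma graph_cycle_if_nbw_not_distinct:
  assumes "nbw w" "\<not> distinct w"
  shows "\<exists>c. graph_cycle E c"
  using assms
proof (induction "length w" arbitrary: w rule: less_induct)
  case less
  obtain xs ys zs y where w: "w = xs @ [y] @ ys @ [y] @ zs"
    using not_distinct_decomp[OF less.prems(2)] by blast
  have n1: "nbw (y # ys)"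
    by (rule nbw_sublist[OF less.prems(1)]) (auto simp: w sublist_def intro: exI[of _ xs])
  have n2: "nbw (y # ys @ [y])"
    by (rule nbw_sublist[OF less.prems(1)]) (auto simp: w sublist_def intro: exI[of _ xs])
  show ?case
  proof (cases "distinct (y # ys)")
    case False
    then show ?thesis using less.hyps[OF _ n1] by (simp add: w)
  next
    case True
    consider "ys = []" | a where "ys = [a]" | a b zs where "ys = a # b # zs"
      by (metis list.exhaust)
    then show ?thesis
    proof cases
      case 1
      then show ?thesis using n2 edge_in[of y y] by (simp add: nbw_Cons_Cons)
    next
      case 2
      then show ?thesis using n2 by (auto simp: nbw_Cons_Cons)
    next
      case 3
      have "successively (\<lambda>u v. {u, v} \<in> E) (y # ys)"
        using n1 by (simp add: nbw_def successively_conv_nth)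
      moreover have "{last (y # ys), hd (y # ys)} \<in> E"
      proof -
        have "(y # ys @ [y]) ! length ys = last (y # ys)"
          by (cases ys rule: rev_cases) (auto simp: nth_append)
        then show ?thesis using nbw_edge[OF n2, of "length ys"] by (simp add: nth_append)
      qed
      ultimately show ?thesis using True 3 by (intro exI[of _ "y # ys"]) (simp add: graph_cycle_def)
    qed
  qed
qed

text \<open>
  A walk is extended by an edge either by appending its end, or by dropping its last vertex when the
  step would undo the previous one.
\<close>
lemma nbw_exists:
  assumes "(u, v) \<in> reachable E" "u \<in> V"
  shows "\<exists>p. nbw p \<and> p \<noteq> [] \<and> hd p = u \<and> last p = v"
  using assms(1) unfolding reachable_def
proof (induction rule: rtrancl_induct)
  case base
  then show ?case using assms(2) by (intro exI[of _ "[u]"]) simp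
next
  case (step v w)
  then obtain p where p: "nbw p" "p \<noteq> []" "hd p = u" "last p = v" by blast
  have vw: "{v, w} \<in> E" using step by simp
  obtain q where q: "p = q @ [v]" using p by (metis append_butlast_last_id)
  show ?case
  proof (cases "q \<noteq> [] \<and> last q = w")
    case True
    have "nbw q" by (rule nbw_sublist[OF p(1)]) (simp add: q)
    then show ?thesis using True p q by (intro exI[of _ q]) auto
  next
    case False
    have "nbw [v, w]" using vw edge_in by (auto simp: nbw_def)
    from nbw_glue[OF p(1)[unfolded q] this] False have "nbw (q @ [v, w])" by auto
    then show ?thesis using p q by (intro exI[of _ "q @ [v, w]"]) (cases q; auto)
  qed
qed

end

locale tree = simple_graph V E for V :: "'v set" and E +
  assumes tree: "is_tree V E" and finV: "finite V"
begin

lemma nbw_distinct: "nbw w \<Longrightarrow> distinct w"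
  using graph_cycle_if_nbw_not_distinct tree by (auto simp: is_tree_def)

text \<open>
  Where two walks with the same start first part, following one backwards and then the other is again
  non-backtracking. If they also had the same end, this would be a closed walk, which a tree does not
  admit.
\<close>
lemma nbw_unique:
  assumes "nbw p" "nbw q" "p \<noteq> []" "q \<noteq> []" "hd p = hd q" "last p = last q"
  shows "p = q"
  using assms
proof (induction p arbitrary: q)
  case Nil
  then show ?case by simp
next
  case (Cons x p)
  obtain q' where q: "q = x # q'" using Cons.prems by (cases q) auto
  have d: "distinct (x # p)" "distinct (x # q')" using nbw_distinct[OF Cons.prems(1)] nbw_distinct[OF Cons.prems(2)] q by auto
  show ?case
  proof (cases "p = [] \<or> q' = []")
    case True
    have "p = [] \<and> q' = []"
    proof (rule ccontr)
      assume "\<not> ?thesis"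
      then show False using True Cons.prems d last_in_set[of p] last_in_set[of q'] q by auto
    qed
    then show ?thesis by (simp add: q)
  next
    case False
    then obtain y p' y' q'' where p': "p = y # p'" and q'': "q' = y' # q''" by (metis list.exhaust)
    have n: "nbw p" "nbw q'" using Cons.prems q p' q'' by (auto simp: nbw_Cons_Cons)
    show ?thesis
    proof (cases "y = y'")
      case True
      then show ?thesis using Cons.IH[OF n] Cons.prems q p' q'' by auto
    next
      case False
      have "nbw (rev p @ [x])" using Cons.prems(1) nbw_rev[of "x # p"] by (simp del: nbw_rev)
      then have "nbw (rev p @ x # q')"
        by (rule nbw_glue) (use Cons.prems(2) q False p' q'' in auto)
      then have "distinct (rev p @ x # q')" by (rule nbw_distinct)
      moreover have "last p = last q'" "last p \<in> set p" "last q' \<in> set q'"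
        using Cons.prems(6) q p' q'' last_in_set[of p] last_in_set[of q'] by auto
      ultimately show ?thesis by auto
    qed
  qed
qed

lemma nbw_connect:
  assumes "u \<in> V" "v \<in> V"
  shows "\<exists>p. nbw p \<and> p \<noteq> [] \<and> hd p = u \<and> last p = v"
  using nbw_exists assms tree by (auto simp: is_tree_def connected_graph_def)

lemma card_nbw: "finite {w. nbw w}" "card {w. nbw w} = 1 + card V ^ 2"
proof -
  let ?W = "{w. nbw w \<and> w \<noteq> []}"
  have bij: "bij_betw (\<lambda>w. (hd w, last w)) ?W (V \<times> V)"
  proof (rule bij_betwI')
    show "((hd v, last v) = (hd w, last w)) = (v = w)" if "v \<in> ?W" "w \<in> ?W" for v w
      using nbw_unique that by auto
    show "(hd w, last w) \<in> V \<times> V" if "w \<in> ?W" for w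
      using that hd_in_set[of w] last_in_set[of w] by (auto simp: nbw_def)
    show "\<exists>w\<in>?W. xy = (hd w, last w)" if "xy \<in> V \<times> V" for xy
      using that nbw_connect[of "fst xy" "snd xy"] by force
  qed
  have fin: "finite ?W" using bij_betw_finite[OF bij] finV by simp
  have eq: "{w. nbw w} = insert [] ?W" by auto
  show "finite {w. nbw w}" using fin by (simp add: eq)
  have "card ?W = card V ^ 2"
    using bij_betw_same_card[OF bij] by (simp add: card_cartesian_product power2_eq_square)
  then show "card {w. nbw w} = 1 + card V ^ 2"
    using fin by (simp add: eq)
qed

end

section \<open>Reduced words of a Coxeter matrix\<close>

definition forbidden :: "'i set \<Rightarrow> ('i \<Rightarrow> 'i \<Rightarrow> enat) \<Rightarrow> ('i \<Rightarrow> nat) \<Rightarrow> 'i list set" where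
  "forbidden I m d = {replicate (d i) i | i. i \<in> I} \<union>
     {alternating a b (the_enat (m a b)) | a b. {a, b} \<in> braid_pairs I m}"

lemma sublist_iff_nth:
  "sublist f w \<longleftrightarrow> (\<exists>t. t + length f \<le> length w \<and> (\<forall>k<length f. w ! (t + k) = f ! k))"
proof
  assume "sublist f w"
  then obtain ps ss where w: "w = ps @ f @ ss" by (auto simp: sublist_def)
  show "\<exists>t. t + length f \<le> length w \<and> (\<forall>k<length f. w ! (t + k) = f ! k)"
    by (rule exI[of _ "length ps"]) (simp add: w nth_append)
next
  assume "\<exists>t. t + length f \<le> length w \<and> (\<forall>k<length f. w ! (t + k) = f ! k)"
  then obtain t where t: "t + length f \<le> length w" "\<And>k. k < length f \<Longrightarrow> w ! (t + k) = f ! k" by blast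
  have "f = take (length f) (drop t w)"
    using t by (intro nth_equalityI) auto
  then have "w = take t w @ f @ drop (length f) (drop t w)"
    by (metis append_take_drop_id)
  then show "sublist f w" by (metis sublist_appendI)
qed

lemma alternating_nth: "k < n \<Longrightarrow> alternating a b n ! k = (if even k then a else b)"
  by (induction n arbitrary: a b k) (auto simp: nth_Cons split: nat.split)

lemma alternating_2: "alternating a b 2 = [a, b]"
  and alternating_3: "alternating a b 3 = [a, b, a]"
  by (simp_all add: eval_nat_numeral)

lemma alternating_not_Nil: "0 < n \<Longrightarrow> alternating a b n \<noteq> []"
  by (cases n) auto

locale coxeter =
  fixes I :: "'i set" and m :: "'i \<Rightarrow> 'i \<Rightarrow> enat" and d :: "'i \<Rightarrow> nat"
  assumes cox: "coxeter_matrix I m" and d2: "i \<in> I \<Longrightarrow> 2 \<le> d i"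
begin

abbreviation E where "E \<equiv> coxeter_edges I m"
abbreviation red where "red \<equiv> reduced_words I (forbidden I m d)"

lemma m_sym: "i \<in> I \<Longrightarrow> j \<in> I \<Longrightarrow> m i j = m j i"
  using cox by (cases "i = j") (auto simp: coxeter_matrix_def)

lemma m_ge2: "i \<in> I \<Longrightarrow> j \<in> I \<Longrightarrow> i \<noteq> j \<Longrightarrow> 2 \<le> m i j"
  using cox by (auto simp: coxeter_matrix_def)

lemma edge_iff: "{i, j} \<in> E \<longleftrightarrow> i \<in> I \<and> j \<in> I \<and> i \<noteq> j \<and> 3 \<le> m i j"
  using m_sym by (auto simp: coxeter_edges_def doubleton_eq_iff)

sublocale simple_graph I E
  by unfold_locales (auto simp: coxeter_edges_def)

lemma forbidden_cases:
  assumes "f \<in> forbidden I m d"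
  obtains (rep) i where "i \<in> I" "f = replicate (d i) i"
    | (alt) a b n where "a \<in> I" "b \<in> I" "a \<noteq> b" "m a b = enat n" "2 \<le> n" "f = alternating a b n"
proof -
  have "\<exists>n. a \<in> I \<and> b \<in> I \<and> a \<noteq> b \<and> m a b = enat n \<and> 2 \<le> n \<and> n = the_enat (m a b)"
    if "{a, b} \<in> braid_pairs I m" for a b
  proof -
    have ab: "a \<in> I" "b \<in> I" "a \<noteq> b" "m a b < \<infinity>"
      using that m_sym by (auto simp: braid_pairs_def doubleton_eq_iff)
    then show ?thesis using m_ge2[OF ab(1-3)] by (cases "m a b") (auto simp: numeral_eq_enat)
  qed
  then show ?thesis using assms rep alt unfolding forbidden_def by blast
qed

lemma forbidden_rep: "i \<in> I \<Longrightarrow> replicate (d i) i \<in> forbidden I m d"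
  by (auto simp: forbidden_def)

lemma forbidden_alt:
  assumes "a \<in> I" "b \<in> I" "a \<noteq> b" "m a b = enat n"
  shows "alternating a b n \<in> forbidden I m d"
proof -
  have "{a, b} \<in> braid_pairs I m" using assms by (auto simp: braid_pairs_def)
  then show ?thesis using assms(4) unfolding forbidden_def
    by (intro UnI2 CollectI exI[of _ a] exI[of _ b]) simp
qed

lemma forbidden_lists: "forbidden I m d \<subseteq> lists I"
proof
  fix f assume "f \<in> forbidden I m d"
  then show "f \<in> lists I"
    by (cases rule: forbidden_cases) (use set_alternating in fastforce)+
qed

lemma forbidden_not_Nil: "f \<in> forbidden I m d \<Longrightarrow> f \<noteq> []"
  by (erule forbidden_cases) (use d2 in \<open>fastforce simp: alternating_not_Nil\<close>)+

lemma red_set: "w \<in> red \<Longrightarrow> set w \<subseteq> I"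
  by (auto simp: reduced_words_def)

lemma red_avoids: "w \<in> red \<Longrightarrow> f \<in> forbidden I m d \<Longrightarrow> \<not> sublist f w"
  by (auto simp: reduced_words_def)

lemma sublist_pair: "Suc t < length w \<Longrightarrow> sublist [w ! t, w ! Suc t] w"
  unfolding sublist_iff_nth by (rule exI[of _ t]) (auto simp: less_Suc_eq)

lemma sublist_triple: "Suc (Suc t) < length w \<Longrightarrow> sublist [w ! t, w ! Suc t, w ! Suc (Suc t)] w"
  unfolding sublist_iff_nth by (rule exI[of _ t]) (auto simp: less_Suc_eq)

text \<open>
  The relators of length two say how a reduced word moves from letter to letter, those of length three
  (in \<open>red_turn\<close>) where it may turn back.
\<close>
lemma red_step:
  assumes w: "w \<in> red" and t: "Suc t < length w"
  shows "{w ! t, w ! Suc t} \<in> E \<or> w ! t = w ! Suc t \<and> 3 \<le> d (w ! t)"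
proof -
  let ?a = "w ! t" and ?b = "w ! Suc t"
  have I: "?a \<in> I" "?b \<in> I" using red_set[OF w] t by auto
  show ?thesis
  proof (cases "?a = ?b")
    case True
    have "d ?a \<noteq> 2"
      using red_avoids[OF w forbidden_rep[OF I(1)]] sublist_pair[OF t] True
      by (auto simp: numeral_2_eq_2)
    then show ?thesis using True d2[OF I(1)] by simp
  next
    case False
    have "m ?a ?b \<noteq> enat 2"
      using red_avoids[OF w forbidden_alt[OF I False]] sublist_pair[OF t] by (auto simp: alternating_2)
    then have "3 \<le> m ?a ?b" using m_ge2[OF I False] by (cases "m ?a ?b") (auto simp: numeral_eq_enat)
    then show ?thesis using I False by (simp add: edge_iff)
  qed
qed

lemma red_turn:
  assumes w: "w \<in> red" and t: "Suc (Suc t) < length w"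
    and eq: "w ! t = w ! Suc (Suc t)" and ne: "w ! t \<noteq> w ! Suc t"
  shows "4 \<le> m (w ! t) (w ! Suc t)"
proof -
  let ?a = "w ! t" and ?b = "w ! Suc t"
  have I: "?a \<in> I" "?b \<in> I" using red_set[OF w] t by auto
  have "{?a, ?b} \<in> E" using red_step[OF w, of t] t ne by auto
  then have "3 \<le> m ?a ?b" by (simp add: edge_iff)
  moreover have "m ?a ?b \<noteq> enat 3"
    using red_avoids[OF w forbidden_alt[OF I ne]] sublist_triple[OF t] eq by (auto simp: alternating_3)
  ultimately show ?thesis by (cases "m ?a ?b") (auto simp: numeral_eq_enat)
qed

lemma redI:
  assumes I: "set w \<subseteq> I"
    and "\<And>t i. i \<in> I \<Longrightarrow> t + d i \<le> length w \<Longrightarrow> (\<And>k. k < d i \<Longrightarrow> w ! (t + k) = i) \<Longrightarrow> False"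
    and "\<And>t a b n. a \<in> I \<Longrightarrow> b \<in> I \<Longrightarrow> a \<noteq> b \<Longrightarrow> m a b = enat n \<Longrightarrow> 2 \<le> n \<Longrightarrow>
       t + n \<le> length w \<Longrightarrow> (\<And>k. k < n \<Longrightarrow> w ! (t + k) = (if even k then a else b)) \<Longrightarrow> False"
  shows "w \<in> red"
proof -
  have "\<not> sublist f w" if "f \<in> forbidden I m d" for f
    using that
  proof (cases rule: forbidden_cases)
    case (rep i)
    then show ?thesis using assms(2) unfolding sublist_iff_nth by auto
  next
    case (alt a b n)
    show ?thesis
    proof
      assume "sublist f w"
      then obtain t where t: "t + n \<le> length w" "\<And>k. k < n \<Longrightarrow> w ! (t + k) = f ! k"
        unfolding sublist_iff_nth using alt(6) by (auto simp: length_alternating)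
      show False
        by (rule assms(3)[OF alt(1-5) t(1)]) (simp add: t(2) alt(6) alternating_nth)
    qed
  qed
  then show ?thesis using I by (auto simp: reduced_words_def)
qed

text \<open>
  Every relator starts with a pause, a step between non-adjacent nodes, or a turn \<open>aba\<close>.
\<close>
lemma nbw_red:
  assumes w: "nbw w"
  shows "w \<in> red"
proof (rule redI)
  show "set w \<subseteq> I" using w by (simp add: nbw_def)
next
  fix t i assume "i \<in> I" "t + d i \<le> length w" and k: "\<And>k. k < d i \<Longrightarrow> w ! (t + k) = i"
  then have "2 \<le> d i" "Suc t < length w" using d2[of i] by auto
  then show False using nbw_edge[OF w, of t] k[of 0] k[of 1] by (simp add: edge_iff)
next
  fix t a b n assume a: "a \<noteq> b" "m a b = enat n" "2 \<le> n" "t + n \<le> length w"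
    and k: "\<And>k. k < n \<Longrightarrow> w ! (t + k) = (if even k then a else b)"
  then have "{a, b} \<in> E" using nbw_edge[OF w, of t] k[of 0] k[of 1] by simp
  then have "3 \<le> n" using a by (simp add: edge_iff numeral_eq_enat)
  then show False using nbw_no_turn[OF w, of t] k[of 0] k[of 2] a by simp
qed

end

section \<open>Decomposition of reduced words at the core\<close>

lemma sublist_within_core:
  assumes "sublist f (u @ r @ v)" "set f \<subseteq> C" "f \<noteq> []" "set u \<inter> C = {}" "set v \<inter> C = {}"
  shows "sublist f r"
proof -
  have no: "xs = []" if "set xs \<subseteq> C" "set xs \<subseteq> set u \<or> set xs \<subseteq> set v" for xs
    using that assms(4,5) by (cases xs) auto
  have "sublist f (r @ v)"
    using assms(1) unfolding sublist_append[of f u]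
  proof (elim disjE exE conjE)
    assume "sublist f u"
    then show ?thesis using no[of f] assms(2) set_mono_sublist[of f u] by simp
  next
    fix xs1 xs2 assume f: "f = xs1 @ xs2" "suffix xs1 u" "prefix xs2 (r @ v)"
    then have "xs1 = []" using no[of xs1] assms(2) set_mono_suffix[of xs1 u] by simp
    then show ?thesis using f by (simp add: prefix_imp_sublist)
  qed
  then show ?thesis
    unfolding sublist_append[of f r]
  proof (elim disjE exE conjE)
    assume "sublist f v"
    then show ?thesis using no[of f] assms(2) set_mono_sublist[of f v] by simp
  next
    fix xs1 xs2 assume f: "f = xs1 @ xs2" "suffix xs1 r" "prefix xs2 v"
    then have "xs2 = []" using no[of xs2] assms(2) set_mono_prefix[of xs2 v] by simp
    then show ?thesis using f by (simp add: suffix_imp_sublist)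
  qed
qed

text \<open>
  The core contains every gadget. That it is a clique is what makes it convex in the tree: a walk
  between two of its nodes does not leave it.
\<close>
locale coxeter_core = coxeter I m d + tree I "coxeter_edges I m"
  for I :: "'i set" and m d +
  fixes C :: "'i set"
  assumes core_sub: "C \<subseteq> I"
    and core_clique: "c \<in> C \<Longrightarrow> c' \<in> C \<Longrightarrow> c \<noteq> c' \<Longrightarrow> {c, c'} \<in> coxeter_edges I m"
    and outside_d: "i \<in> I \<Longrightarrow> i \<notin> C \<Longrightarrow> d i = 2"
    and outside_m: "{i, j} \<in> coxeter_edges I m \<Longrightarrow> i \<notin> C \<or> j \<notin> C \<Longrightarrow> m i j = 3"
begin

text \<open>
  Pausing and turning happen on two consecutive core letters only.
\<close>
lemma nbw_if_core_free:
  assumes w: "w \<in> red"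
    and "\<And>t. Suc t < length w \<Longrightarrow> w ! t \<notin> C \<or> w ! Suc t \<notin> C"
  shows "nbw w"
proof -
  have step: "{w ! t, w ! Suc t} \<in> E" if t: "Suc t < length w" for t
  proof -
    have "w ! t \<in> I" using red_set[OF w] t by auto
    then show ?thesis using red_step[OF w t] assms(2)[OF t] outside_d[of "w ! t"] by auto
  qed
  moreover have "w ! t \<noteq> w ! Suc (Suc t)" if t: "Suc (Suc t) < length w" for t
  proof
    assume "w ! t = w ! Suc (Suc t)"
    moreover have e: "{w ! t, w ! Suc t} \<in> E" using t by (intro step) simp
    ultimately have "4 \<le> m (w ! t) (w ! Suc t)"
      using red_turn[OF w t] by (auto simp: edge_iff)
    moreover have "m (w ! t) (w ! Suc t) = 3"
      using outside_m[OF e] assms(2)[of t] t by simp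
    ultimately show False by simp
  qed
  ultimately show ?thesis using red_set[OF w] by (simp add: nbw_def)
qed

lemma core_to_core:
  assumes "nbw (c # z @ [c'])" "c \<in> C" "c' \<in> C"
  shows "z = []"
proof (cases "c = c'")
  case True
  then show ?thesis using nbw_distinct[OF assms(1)] by simp
next
  case False
  have "nbw [c, c']" using core_clique[OF assms(2,3) False] core_sub assms by (auto simp: nbw_Cons_Cons)
  from nbw_unique[OF assms(1) this] show ?thesis by simp
qed

text \<open>
  An excursion out of the core would be a non-backtracking walk with both ends in the core and all
  inner nodes outside, in contradiction to \<open>core_to_core\<close>.
\<close>
lemma core_run:
  assumes r: "r \<in> red" "r \<noteq> []" "hd r \<in> C" "last r \<in> C"
  shows "set r \<subseteq> C"
proof (rule ccontr)
  assume "\<not> set r \<subseteq> C"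
  then have "\<exists>x\<in>set r. x \<notin> C" by auto
  then obtain p z0 q where p: "r = p @ z0 # q" "z0 \<notin> C" "\<forall>x\<in>set p. x \<in> C"
    using split_list_first_prop[of r "\<lambda>x. x \<notin> C"] by auto
  have "p \<noteq> []" using p r(3) by auto
  then obtain p' c where p': "p = p' @ [c]" by (metis rev_exhaust)
  have "\<exists>x\<in>set q. x \<in> C" using p r(4) by (metis last.simps last_append last_in_set list.distinct(1))
  then obtain z c' q' where q: "q = z @ c' # q'" "c' \<in> C" "\<forall>x\<in>set z. x \<notin> C"
    using split_list_first_prop[of q "\<lambda>x. x \<in> C"] by auto
  let ?f = "c # (z0 # z) @ [c']"
  have "sublist ?f r"
    unfolding sublist_def by (rule exI[of _ p'], rule exI[of _ q']) (simp add: p p' q)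
  then have f: "?f \<in> red" using r(1) by (rule reduced_words_sublist[rotated])
  have mid: "?f ! k \<notin> C" if k: "0 < k" "k < Suc (length (z0 # z))" for k
  proof -
    obtain k' where k': "k = Suc k'" "k' < length (z0 # z)" using k by (cases k) auto
    then have "?f ! k = (z0 # z) ! k'" by (simp add: nth_append nth_Cons split: nat.split)
    then show ?thesis using k' p q by (metis nth_mem set_ConsD)
  qed
  have "nbw ?f"
  proof (rule nbw_if_core_free[OF f])
    fix t assume "Suc t < length ?f"
    then show "?f ! t \<notin> C \<or> ?f ! Suc t \<notin> C"
      using mid[of t] mid[of "Suc t"] by (cases t) auto
  qed
  then have "z0 # z = []" by (rule core_to_core) (use p p' q in auto)
  then show False by simp
qed

definition core_turns :: "'i list set" where
  "core_turns = {r \<in> red. set r \<subseteq> C \<and> \<not> nbw r}"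

text \<open>
  The core letter \<open>c\<close> itself is left off, so that \<open>u @ r\<close> with \<open>hd r = c\<close> is the concatenation of a
  word outside the core and a core word.
\<close>
definition branch :: "'i \<Rightarrow> 'i list set" where
  "branch c = {u. set u \<inter> C = {} \<and> nbw (u @ [c])}"

lemma branch_rev: "rev v \<in> branch c \<longleftrightarrow> set v \<inter> C = {} \<and> nbw (c # v)"
  using nbw_rev[of "c # v"] by (simp add: branch_def del: nbw_rev)

lemma core_turns_length: "r \<in> core_turns \<Longrightarrow> 2 \<le> length r"
  using core_sub by (cases r rule: list.exhaust; cases "tl r") (auto simp: core_turns_def)

text \<open>
  A reduced word can fail to be a non-backtracking walk only at a pause or a turn in the core, so the
  core part of the word is responsible for the failure.
\<close>
lemma core_violation:
  assumes w: "w \<in> red" "\<not> nbw w"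
  shows "\<exists>f. sublist f w \<and> set f \<subseteq> C \<and> f \<noteq> [] \<and> \<not> nbw f"
proof -
  have I: "w ! t \<in> I" if "t < length w" for t using red_set[OF w(1)] that by auto
  consider t where "Suc t < length w" "{w ! t, w ! Suc t} \<notin> E"
    | t where "Suc (Suc t) < length w" "w ! t = w ! Suc (Suc t)" "{w ! t, w ! Suc t} \<in> E"
    using w red_set[OF w(1)] unfolding nbw_def by (meson Suc_lessD)
  then show ?thesis
  proof cases
    case 1
    then have "w ! t = w ! Suc t" "3 \<le> d (w ! t)" using red_step[OF w(1) 1(1)] by auto
    then have "w ! t \<in> C" using outside_d[of "w ! t"] I[of t] 1 by force
    moreover have "\<not> nbw [w ! t, w ! Suc t]" using 1 by (simp add: nbw_Cons_Cons)
    ultimately show ?thesis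
      using sublist_pair[OF 1(1)] \<open>w ! t = w ! Suc t\<close> by (intro exI[of _ "[w ! t, w ! Suc t]"]) auto
  next
    case 2
    then have "4 \<le> m (w ! t) (w ! Suc t)" using red_turn[OF w(1) 2(1)] by (auto simp: edge_iff)
    then have "w ! t \<in> C" "w ! Suc t \<in> C" using outside_m[OF 2(3)] by fastforce+
    moreover have "\<not> nbw [w ! t, w ! Suc t, w ! Suc (Suc t)]" using 2 by (simp add: nbw_Cons_Cons)
    ultimately show ?thesis
      using sublist_triple[OF 2(1)] 2(2)
      by (intro exI[of _ "[w ! t, w ! Suc t, w ! Suc (Suc t)]"]) auto
  qed
qed

text \<open>
  Cut the word before its first and after its last core letter.
\<close>
lemma red_decompose:
  assumes w: "w \<in> red" "\<not> nbw w"
  obtains u r v where "w = u @ r @ rev v" "r \<in> core_turns" "u \<in> branch (hd r)" "v \<in> branch (last r)"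
proof -
  obtain f where f: "sublist f w" "set f \<subseteq> C" "f \<noteq> []" "\<not> nbw f" using core_violation[OF w] by blast
  then have "\<exists>x\<in>set w. x \<in> C" using set_mono_sublist[OF f(1)] by (cases f) auto
  then obtain u x s where u: "w = u @ x # s" "x \<in> C" "\<forall>y\<in>set u. y \<notin> C"
    using split_list_first_prop[of w "\<lambda>x. x \<in> C"] by auto
  then obtain p y v where v: "x # s = p @ y # v" "y \<in> C" "\<forall>y\<in>set v. y \<notin> C"
    using split_list_last_prop[of "x # s" "\<lambda>x. x \<in> C"] by auto
  define r where "r = p @ [y]"
  have weq: "w = u @ r @ v" using u v by (simp add: r_def)
  have hl: "hd r = x" "last r = y" using v(1) by (auto simp: r_def hd_append) (cases p; auto)
  have disj: "set u \<inter> C = {}" "set v \<inter> C = {}" using u v by auto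
  have rr: "r \<in> red" using w(1) by (rule reduced_words_sublist) (simp add: weq)
  have rC: "set r \<subseteq> C" using rr by (rule core_run) (use hl u v in \<open>auto simp: r_def\<close>)
  have "sublist f r" using f disj by (intro sublist_within_core[of f u r v C]) (auto simp: weq)
  then have "\<not> nbw r" using f(4) nbw_sublist by blast
  then have "r \<in> core_turns" using rr rC by (simp add: core_turns_def)
  moreover have "u \<in> branch (hd r)"
  proof -
    have "u @ [hd r] \<in> red"
      using w(1) by (rule reduced_words_sublist)
        (auto simp: u hl sublist_def intro: exI[of _ "[]"] exI[of _ s])
    then have "nbw (u @ [hd r])"
      by (rule nbw_if_core_free) (use u in \<open>auto simp: nth_append\<close>)
    then show ?thesis using disj by (simp add: branch_def)
  qed
  moreover have "rev v \<in> branch (last r)"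
  proof -
    have "last r # v \<in> red"
      using w(1) by (rule reduced_words_sublist)
        (auto simp: u v hl intro!: suffix_imp_sublist suffixI[of _ "u @ p"])
    then have "nbw (last r # v)"
      by (rule nbw_if_core_free) (use v in \<open>auto simp: nth_append\<close>)
    then show ?thesis using disj by (simp add: branch_rev)
  qed
  ultimately show ?thesis using that[of u r "rev v"] weq by simp
qed

text \<open>
  A relator in core letters would have to lie inside \<open>r\<close>, because core letters occur only there. Any
  other relator contains a pause, a non-edge or a turn that involves letters outside the core. As \<open>r\<close>
  has at least two letters, a window of three letters that reaches two letters into \<open>r\<close> joins a letter
  outside the core to a core letter and is not a turn; all other windows with letters outside the
  core lie in one of the walks \<open>u @ [hd r]\<close> and \<open>last r # rev v\<close>.
\<close>
lemma red_compose:
  assumes r: "r \<in> core_turns" and u: "u \<in> branch (hd r)" and v: "v \<in> branch (last r)"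
  shows "u @ r @ rev v \<in> red" "\<not> nbw (u @ r @ rev v)"
proof -
  have rC: "set r \<subseteq> C" "r \<in> red" "\<not> nbw r" using r by (auto simp: core_turns_def)
  show "\<not> nbw (u @ r @ rev v)" using rC(3) nbw_sublist by (metis sublist_appendI)
  define w where "w = u @ r @ rev v"
  \<comment> \<open>the position of the last core letter\<close>
  define q where "q = length u + length r - 1"
  have len: "2 \<le> length r" using r by (rule core_turns_length)
  have rne: "r \<noteq> []" using len by auto
  have nu: "nbw (u @ [hd r])" "set u \<inter> C = {}" using u by (auto simp: branch_def)
  have nv: "nbw (last r # rev v)" "set (rev v) \<inter> C = {}"
    using v branch_rev[of "rev v" "last r"] by auto
  have left: "w ! k = (u @ [hd r]) ! k" if "k \<le> length u" for k
    using that rne by (auto simp: w_def nth_append hd_conv_nth)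
  have right: "w ! k = (last r # rev v) ! (k - q)" if k: "q \<le> k" for k
  proof (cases "k = q")
    case True
    then show ?thesis using rne len by (auto simp: w_def q_def nth_append last_conv_nth)
  next
    case False
    then obtain j where "k = Suc (q + j)" using k less_imp_Suc_add[of q k] by auto
    then show ?thesis using len by (auto simp: w_def q_def nth_append)
  qed
  have inC: "w ! k \<in> C" if "length u \<le> k" "k \<le> q" for k
    using that rC(1) len by (auto simp: w_def q_def nth_append)
  have outC: "w ! k \<notin> C" if "k < length u" for k
  proof -
    have "w ! k \<in> set u" using that by (simp add: w_def nth_append)
    then show ?thesis using nu by auto
  qed
  have lw: "length w = Suc (q + length v)" using len by (simp add: w_def q_def)
  have lu: "Suc (length u) \<le> q" using len by (simp add: q_def)
  have step: "{w ! t, w ! Suc t} \<in> E" if t: "Suc t < length w" "w ! t \<notin> C \<or> w ! Suc t \<notin> C" for t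
  proof -
    consider "Suc t \<le> length u" | "q \<le> t" | "length u \<le> t" "Suc t \<le> q" by linarith
    then show ?thesis
    proof cases
      case 1
      then show ?thesis using nbw_edge[OF nu(1), of t] left[of t] left[of "Suc t"] by simp
    next
      case 2
      then show ?thesis
        using nbw_edge[OF nv(1), of "t - q"] right[of t] right[of "Suc t"] t lw by (simp add: Suc_diff_le)
    next
      case 3
      then show ?thesis using inC[of t] inC[of "Suc t"] t by simp
    qed
  qed
  have turn: "w ! t \<noteq> w ! Suc (Suc t)" if t: "Suc (Suc t) < length w" "w ! t \<notin> C \<or> w ! Suc t \<notin> C" for t
  proof -
    consider "Suc (Suc t) \<le> length u" | "Suc t = length u" | "q \<le> t" | "length u \<le> t" "Suc t \<le> q" by linarith
    then show ?thesis
    proof cases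
      case 1
      then show ?thesis using nbw_no_turn[OF nu(1), of t] left[of t] left[of "Suc (Suc t)"] by simp
    next
      case 2
      then show ?thesis using outC[of t] inC[of "Suc (Suc t)"] lu by auto
    next
      case 3
      then have "Suc (Suc t) - q = Suc (Suc (t - q))" by simp
      then show ?thesis
        using nbw_no_turn[OF nv(1), of "t - q"] right[of t] right[of "Suc (Suc t)"] t lw 3 by simp
    next
      case 4
      then show ?thesis using inC[of t] inC[of "Suc t"] t by simp
    qed
  qed
  have core: "\<not> sublist f w" if "f \<in> forbidden I m d" "set f \<subseteq> C" for f
    using sublist_within_core[of f u r "rev v" C] red_avoids[OF rC(2) that(1)] forbidden_not_Nil[OF that(1)] that
      nu(2) nv(2) by (auto simp: w_def)
  have "w \<in> red"
  proof (rule redI)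
    show "set w \<subseteq> I" using nu(1) nv(1) rC core_sub by (auto simp: nbw_def w_def)
  next
    fix t i assume i: "i \<in> I" "t + d i \<le> length w" and k: "\<And>k. k < d i \<Longrightarrow> w ! (t + k) = i"
    have "i \<notin> C"
    proof
      assume "i \<in> C"
      then have "set (replicate (d i) i) \<subseteq> C" by auto
      moreover have "sublist (replicate (d i) i) w" unfolding sublist_iff_nth using i k by (intro exI[of _ t]) simp
      ultimately show False using core forbidden_rep[OF i(1)] by blast
    qed
    then show False using step[of t] i k[of 0] k[of 1] d2[OF i(1)] by (simp add: edge_iff)
  next
    fix t a b n assume a: "a \<in> I" "b \<in> I" "a \<noteq> b" "m a b = enat n" "2 \<le> n" "t + n \<le> length w"
      and k: "\<And>k. k < n \<Longrightarrow> w ! (t + k) = (if even k then a else b)"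
    have ab: "a \<notin> C \<or> b \<notin> C"
    proof (rule ccontr)
      assume "\<not> ?thesis"
      then have "set (alternating a b n) \<subseteq> C" using set_alternating[of a b n] by auto
      moreover have "sublist (alternating a b n) w" unfolding sublist_iff_nth
        using a k by (intro exI[of _ t]) (simp add: length_alternating alternating_nth)
      ultimately show False using core forbidden_alt[OF a(1-4)] by blast
    qed
    then have e: "{a, b} \<in> E" using step[of t] k[of 0] k[of 1] a by simp
    then have "3 \<le> n" using a by (simp add: edge_iff numeral_eq_enat)
    then show False using turn[of t] k[of 0] k[of 1] k[of 2] a ab by simp
  qed
  then show "u @ r @ rev v \<in> red" by (simp add: w_def)
qed

lemma finite_branch: "finite (branch c)"
proof (rule finite_subset)
  show "branch c \<subseteq> butlast ` {w. nbw w}" by (force simp: branch_def image_iff)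
  show "finite (butlast ` {w. nbw w})" using card_nbw(1) by simp
qed

text \<open>
  The pieces of \<open>u @ r @ rev v\<close> can be read off from the word, as \<open>r\<close> consists of its core letters.
  Reversing \<open>v\<close> lets the same set of branches describe both ends.
\<close>
theorem card_red:
  assumes fin: "finite core_turns"
  shows "finite red"
    "card red = 1 + card I ^ 2 + (\<Sum>r\<in>core_turns. card (branch (hd r)) * card (branch (last r)))"
proof -
  let ?T = "Sigma core_turns (\<lambda>r. branch (hd r) \<times> branch (last r))"
  let ?f = "\<lambda>(r, u, v). u @ r @ rev v"
  have eq: "red = {w. nbw w} \<union> ?f ` ?T"
  proof
    show "red \<subseteq> {w. nbw w} \<union> ?f ` ?T"
    proof
      fix w assume w: "w \<in> red"
      show "w \<in> {w. nbw w} \<union> ?f ` ?T"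
      proof (cases "nbw w")
        case False
        obtain u r v where "w = u @ r @ rev v" "r \<in> core_turns" "u \<in> branch (hd r)" "v \<in> branch (last r)"
          using red_decompose[OF w False] .
        then have "w = ?f (r, u, v)" "(r, u, v) \<in> ?T" by auto
        then show ?thesis by blast
      qed simp
    qed
    show "{w. nbw w} \<union> ?f ` ?T \<subseteq> red" using nbw_red red_compose(1) by auto
  qed
  have disj: "{w. nbw w} \<inter> ?f ` ?T = {}" using red_compose(2) by auto
  have inj: "inj_on ?f ?T"
  proof -
    have cut: "u = takeWhile (\<lambda>x. x \<notin> C) (u @ r @ rev v)" "r = takeWhile (\<lambda>x. x \<in> C) (r @ rev v)"
      if "(r, u, v) \<in> ?T" for u r v
    proof -
      have r: "set r \<subseteq> C" "r \<noteq> []" using that core_turns_length[of r] by (auto simp: core_turns_def)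
      have u: "set u \<inter> C = {}" "set v \<inter> C = {}" using that by (auto simp: branch_def)
      have "takeWhile (\<lambda>x. x \<notin> C) (r @ rev v) = []" using r by (cases r) auto
      then show "u = takeWhile (\<lambda>x. x \<notin> C) (u @ r @ rev v)" using u by (subst takeWhile_append2) auto
      have "takeWhile (\<lambda>x. x \<in> C) (rev v) = []" using u(2) by (cases "rev v") (auto simp: rev_eq_Cons_iff)
      then show "r = takeWhile (\<lambda>x. x \<in> C) (r @ rev v)" using r by (subst takeWhile_append2) auto
    qed
    show ?thesis
    proof (rule inj_onI)
      fix x y assume x: "x \<in> ?T" and y: "y \<in> ?T" and xy: "?f x = ?f y"
      obtain r u v r' u' v' where e: "x = (r, u, v)" "y = (r', u', v')" by (metis prod_cases3)
      have "u = u'" using cut(1)[of r u v] cut(1)[of r' u' v'] x y xy e by simp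
      moreover from this have rv: "r @ rev v = r' @ rev v'" using xy e by simp
      moreover have "r = r'" using cut(2)[of r u v] cut(2)[of r' u' v'] x y e rv by simp
      ultimately show "x = y" using e by simp
    qed
  qed
  have finT: "finite ?T" using fin finite_branch by auto
  show "finite red" unfolding eq using finT card_nbw(1) by simp
  have "card red = card {w. nbw w} + card (?f ` ?T)"
    unfolding eq using finT card_nbw(1) disj by (intro card_Un_disjoint) auto
  also have "card (?f ` ?T) = (\<Sum>r\<in>core_turns. card (branch (hd r)) * card (branch (last r)))"
    using inj fin finite_branch by (simp add: card_image card_cartesian_product)
  finally show "card red = 1 + card I ^ 2 + (\<Sum>r\<in>core_turns. card (branch (hd r)) * card (branch (last r)))"
    by (simp add: card_nbw)
qed

end

section \<open>Counting reduced words in the two finite cases\<close>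

context coxeter_core
begin

text \<open>
  By uniqueness of walks in a tree, a branch is determined by the node where it starts. The
  one-letter walk at \<open>c\<close> corresponds to the empty branch, whence the detour over \<open>u @ [c]\<close>.
\<close>
lemma inj_branch: "inj_on (\<lambda>u. hd (u @ [c])) (branch c)"
proof (rule inj_onI)
  fix u v assume "u \<in> branch c" "v \<in> branch c" "hd (u @ [c]) = hd (v @ [c])"
  then have "u @ [c] = v @ [c]" by (intro nbw_unique) (auto simp: branch_def)
  then show "u = v" by simp
qed

lemma card_branch: "card (branch c) = card ((\<lambda>u. hd (u @ [c])) ` branch c)"
  by (simp add: card_image inj_branch)

end

context coxeter
begin

text \<open>
  The core is \<open>{i0}\<close> and its turning words are the powers of \<open>i0\<close> with exponent from \<open>2\<close> to
  \<open>d i0 - 1\<close>; every node starts exactly one branch. If \<open>d i0 = 2\<close>, there are no turning words, and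
  \<open>i0\<close> may be any node.
\<close>
lemma simply_laced_count:
  assumes tree: "is_tree I E" and sl: "simply_laced I m" and i0: "i0 \<in> I"
    and d: "\<And>i. i \<in> I \<Longrightarrow> i \<noteq> i0 \<Longrightarrow> d i = 2"
  shows "finite red" "card red = 1 + card I ^ 2 * (d i0 - 1)"
proof -
  interpret coxeter_core I m d "{i0}"
  proof unfold_locales
    show "is_tree I E" "finite I" using tree cox by (simp_all add: coxeter_matrix_def)
    show "m i j = 3" if "{i, j} \<in> E" for i j
      using that sl by (intro antisym) (auto simp: edge_iff simply_laced_def)
  qed (use i0 d in auto)
  have "(\<lambda>u. hd (u @ [i0])) ` branch i0 = I"
  proof
    show "(\<lambda>u. hd (u @ [i0])) ` branch i0 \<subseteq> I"
    proof
      fix x assume "x \<in> (\<lambda>u. hd (u @ [i0])) ` branch i0"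
      then obtain u where "nbw (u @ [i0])" "x = hd (u @ [i0])" by (auto simp: branch_def)
      then show "x \<in> I" using hd_in_set[of "u @ [i0]"] by (auto simp: nbw_def)
    qed
    show "I \<subseteq> (\<lambda>u. hd (u @ [i0])) ` branch i0"
    proof
      fix x assume "x \<in> I"
      then obtain p where p: "nbw p" "p \<noteq> []" "hd p = x" "last p = i0" using nbw_connect i0 by blast
      then obtain u where u: "p = u @ [i0]" by (metis append_butlast_last_id)
      then have "u \<in> branch i0" using p nbw_distinct[OF p(1)] by (auto simp: branch_def)
      then show "x \<in> (\<lambda>u. hd (u @ [i0])) ` branch i0" using p u by (intro image_eqI[of _ _ u]) auto
    qed
  qed
  then have br: "card (branch i0) = card I" by (simp add: card_branch)
  have turns: "core_turns = (\<lambda>k. replicate k i0) ` {2..<d i0}"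
  proof
    show "core_turns \<subseteq> (\<lambda>k. replicate k i0) ` {2..<d i0}"
    proof
      fix r assume r: "r \<in> core_turns"
      then have "set r \<subseteq> {i0}" "r \<in> red" by (auto simp: core_turns_def)
      then have rep: "r = replicate (length r) i0" by (intro replicate_eqI) auto
      have "length r < d i0"
      proof (rule ccontr)
        assume "\<not> ?thesis"
        then have "r = replicate (d i0) i0 @ replicate (length r - d i0) i0"
          using rep by (simp flip: replicate_add)
        then have "sublist (replicate (d i0) i0) r" by (metis sublist_append_rightI)
        then show False using red_avoids[OF \<open>r \<in> red\<close> forbidden_rep[OF i0]] by simp
      qed
      then show "r \<in> (\<lambda>k. replicate k i0) ` {2..<d i0}"
        using core_turns_length[OF r] rep by (intro image_eqI[of _ _ "length r"]) auto
    qed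
    show "(\<lambda>k. replicate k i0) ` {2..<d i0} \<subseteq> core_turns"
    proof
      fix r assume "r \<in> (\<lambda>k. replicate k i0) ` {2..<d i0}"
      then obtain k where k: "r = replicate k i0" "2 \<le> k" "k < d i0" by auto
      have "r \<in> red"
      proof (rule redI)
        show "set r \<subseteq> I" using k i0 by auto
      next
        fix t i assume i: "i \<in> I" "t + d i \<le> length r" "\<And>j. j < d i \<Longrightarrow> r ! (t + j) = i"
        then have "r ! t = i" using i(3)[of 0] d2[OF i(1)] by simp
        then have "i = i0" using i d2[OF i(1)] by (simp add: k)
        then show False using i k by simp
      next
        fix t a b n assume "a \<noteq> b" "2 \<le> n" "t + n \<le> length r"
          and j: "\<And>j. j < n \<Longrightarrow> r ! (t + j) = (if even j then a else b)"
        then show False using j[of 0] j[of 1] by (simp add: k)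
      qed
      moreover have "\<not> nbw r" using nbw_edge[of r 0] edge_in[of i0 i0] k by auto
      ultimately show "r \<in> core_turns" using k by (auto simp: core_turns_def)
    qed
  qed
  have fin: "finite core_turns" by (simp add: turns)
  show "finite red" using card_red(1)[OF fin] .
  have "(\<Sum>r\<in>core_turns. card (branch (hd r)) * card (branch (last r))) =
      (\<Sum>k\<in>{2..<d i0}. card I * card I)"
    unfolding turns
    by (subst sum.reindex) (auto simp: inj_on_def br replicate_eq_replicate intro!: sum.cong)
  also have "\<dots> = (d i0 - 2) * card I ^ 2" by (simp add: power2_eq_square)
  finally have "card red = 1 + card I ^ 2 + (d i0 - 2) * card I ^ 2" using card_red(2)[OF fin] by simp
  moreover obtain e where "d i0 = e + 2" using d2[OF i0] by (metis le_add_diff_inverse2)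
  ultimately show "card red = 1 + card I ^ 2 * (d i0 - 1)" by (simp add: algebra_simps)
qed

end

context tree
begin

lemma nbw_reach:
  assumes "nbw p" "p \<noteq> []" "j \<notin> set p"
  shows "(last p, hd p) \<in> reachable (E - {{i, j}})"
  using assms
proof (induction p)
  case (Cons x p)
  show ?case
  proof (cases p)
    case (Cons y q)
    then have "(last p, y) \<in> reachable (E - {{i, j}})" using Cons.IH Cons.prems by (auto simp: nbw_Cons_Cons)
    moreover have "{y, x} \<in> E - {{i, j}}"
      using Cons.prems Cons by (auto simp: nbw_Cons_Cons doubleton_eq_iff insert_commute)
    ultimately show ?thesis using Cons unfolding reachable_def
      by (auto intro: rtrancl_into_rtrancl)
  qed (simp add: reachable_def)
qed simp

text \<open>
  Removing an edge \<open>{i, j}\<close> of a tree leaves as the component of \<open>i\<close> the vertices whose walk to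
  \<open>i\<close> avoids \<open>j\<close>: the only non-backtracking walk from \<open>i\<close> to \<open>j\<close> is the edge that was removed.
\<close>
lemma component_eq:
  assumes ij: "{i, j} \<in> E"
  shows "component V (E - {{i, j}}) i = {hd (u @ [i]) | u. nbw (u @ [i]) \<and> j \<notin> set u}"
proof
  have ne: "i \<noteq> j" "i \<in> V" "j \<in> V" using edge_in[OF ij] by auto
  show "{hd (u @ [i]) | u. nbw (u @ [i]) \<and> j \<notin> set u} \<subseteq> component V (E - {{i, j}}) i"
  proof
    fix x assume "x \<in> {hd (u @ [i]) | u. nbw (u @ [i]) \<and> j \<notin> set u}"
    then obtain u where u: "nbw (u @ [i])" "j \<notin> set u" "x = hd (u @ [i])" by blast
    have "x \<in> V" using u hd_in_set[of "u @ [i]"] by (auto simp: nbw_def)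
    moreover have "(i, x) \<in> reachable (E - {{i, j}})"
      using nbw_reach[OF u(1), of j i] u ne by auto
    ultimately show "x \<in> component V (E - {{i, j}}) i" by (simp add: component_def)
  qed
  show "component V (E - {{i, j}}) i \<subseteq> {hd (u @ [i]) | u. nbw (u @ [i]) \<and> j \<notin> set u}"
  proof
    fix x assume x: "x \<in> component V (E - {{i, j}}) i"
    interpret G: simple_graph V "E - {{i, j}}" by unfold_locales (use edgeE in auto)
    obtain p where p: "G.nbw p" "p \<noteq> []" "hd p = i" "last p = x"
      using G.nbw_exists[of i x] x ne by (auto simp: component_def)
    have sub: "nbw q" if "G.nbw q" for q using that by (auto simp: nbw_def G.nbw_def)
    have "j \<notin> set p"
    proof
      assume "j \<in> set p"
      then obtain q s where q: "p = q @ j # s" by (metis split_list)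
      have "q \<noteq> []" using p ne q by auto
      have g: "G.nbw (q @ [j])" using p(1) by (rule G.nbw_sublist) (auto simp: q sublist_def intro: exI[of _ "[]"] exI[of _ s])
      have "nbw [i, j]" using ij ne by (simp add: nbw_Cons_Cons)
      from nbw_unique[OF sub[OF g] this] have "q @ [j] = [i, j]"
        using p(3) q \<open>q \<noteq> []\<close> by (simp add: hd_append)
      then show False using g by (simp add: G.nbw_Cons_Cons)
    qed
    moreover obtain u where u: "rev p = u @ [i]" using p by (metis append_butlast_last_id last_rev rev_is_Nil_conv)
    moreover have "nbw (u @ [i])" using sub[OF p(1)] nbw_rev[of p] u by simp
    moreover have "hd (u @ [i]) = x" using p u by (metis hd_rev)
    moreover have "set p = set (u @ [i])" using u by (metis set_rev)
    ultimately show "x \<in> {hd (u @ [i]) | u. nbw (u @ [i]) \<and> j \<notin> set u}" by auto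
  qed
qed

lemma components_partition:
  assumes ij: "{i, j} \<in> E"
  shows "component V (E - {{i, j}}) i \<inter> component V (E - {{i, j}}) j = {}"
    "component V (E - {{i, j}}) i \<union> component V (E - {{i, j}}) j = V"
proof -
  have ji: "{j, i} \<in> E" using ij by (simp add: insert_commute)
  have ne: "i \<noteq> j" "i \<in> V" "j \<in> V" using edge_in[OF ij] by auto
  have ej: "component V (E - {{i, j}}) j = {hd (u @ [j]) | u. nbw (u @ [j]) \<and> i \<notin> set u}"
    using component_eq[OF ji] by (simp add: insert_commute)
  show "component V (E - {{i, j}}) i \<inter> component V (E - {{i, j}}) j = {}"
  proof (rule ccontr)
    assume "\<not> ?thesis"
    then obtain u v where u: "nbw (u @ [i])" "j \<notin> set u" and v: "nbw (v @ [j])" "i \<notin> set v"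
      and h: "hd (u @ [i]) = hd (v @ [j])"
      unfolding ej component_eq[OF ij] by auto
    have "nbw [i, j]" using ij ne by (simp add: nbw_Cons_Cons)
    moreover have "u \<noteq> [] \<Longrightarrow> last u \<noteq> j" using u(2) last_in_set[of u] by metis
    ultimately have "nbw (u @ [i, j])" using nbw_glue[OF u(1), of "[j]"] by simp
    then have "u @ [i, j] = v @ [j]" using v(1) h by (intro nbw_unique) (cases u; auto)+
    then show False using v(2) by (metis append.assoc append_Cons append_Nil butlast_snoc in_set_conv_decomp)
  qed
  show "component V (E - {{i, j}}) i \<union> component V (E - {{i, j}}) j = V"
  proof
    show "component V (E - {{i, j}}) i \<union> component V (E - {{i, j}}) j \<subseteq> V" by (auto simp: component_def)
    show "V \<subseteq> component V (E - {{i, j}}) i \<union> component V (E - {{i, j}}) j"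
    proof
      fix x assume "x \<in> V"
      then obtain p where p: "nbw p" "p \<noteq> []" "hd p = x" "last p = i" using nbw_connect ne by blast
      then obtain u where u: "p = u @ [i]" by (metis append_butlast_last_id)
      show "x \<in> component V (E - {{i, j}}) i \<union> component V (E - {{i, j}}) j"
      proof (cases "j \<in> set u")
        case False
        then show ?thesis using p u unfolding component_eq[OF ij] by (intro UnI1 CollectI exI[of _ u]) auto
      next
        case True
        then obtain q s where q: "u = q @ j # s" by (metis split_list)
        have "nbw (q @ [j])" using p(1)
          by (rule nbw_sublist) (simp add: u q sublist_def, intro exI[of _ "[]"] exI[of _ "s @ [i]"], simp)
        moreover have "i \<notin> set q" using nbw_distinct[OF p(1)] u q by auto
        moreover have "x = hd (q @ [j])" using p u q by (cases q) auto
        ultimately show ?thesis unfolding ej by blast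
      qed
    qed
  qed
qed

end

lemma alternating_eqI:
  assumes "set r \<subseteq> {a, b}" "r \<noteq> [] \<Longrightarrow> hd r = a" "\<And>t. Suc t < length r \<Longrightarrow> r ! t \<noteq> r ! Suc t"
  shows "r = alternating a b (length r)"
  using assms
proof (induction r arbitrary: a b)
  case (Cons x r)
  have "r = alternating b a (length r)"
  proof (rule Cons.IH)
    show "set r \<subseteq> {b, a}" using Cons.prems(1) by auto
    show "hd r = b" if "r \<noteq> []"
      using Cons.prems(1,2) Cons.prems(3)[of 0] that by (cases r) auto
    show "r ! t \<noteq> r ! Suc t" if "Suc t < length r" for t
      using Cons.prems(3)[of "Suc t"] that by simp
  qed
  then show ?case using Cons.prems(2) by simp
qed simp

lemma last_alternating: "0 < k \<Longrightarrow> last (alternating a b k) = (if odd k then a else b)"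
  using alternating_nth[of "k - 1" k a b] last_conv_nth[of "alternating a b k"]
  by (simp add: length_alternating alternating_not_Nil)

lemma hd_alternating: "0 < k \<Longrightarrow> hd (alternating a b k) = a"
  by (cases k) auto

text \<open>
  The sum runs over the lengths \<open>k\<close> of the alternating core words. One that starts at the side of \<open>A\<close>
  returns to that side if \<open>k\<close> is odd and ends on the other side if \<open>k\<close> is even.
\<close>
lemma turn_sum:
  fixes A B :: nat
  assumes "3 \<le> M"
  shows "real (1 + (A + B)\<^sup>2 + (\<Sum>k=3..<M. A * (if odd k then A else B) + B * (if odd k then B else A))) =
    (if even M then 1 / 2 * real M * (real (A + B))\<^sup>2 + 1 - 2 * real A * real B
     else 1 / 2 * (real M - 1) * (real (A + B))\<^sup>2 + 1)"
  using assms
proof (induction M rule: nat_induct_at_least)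
  case base
  then show ?case by simp
next
  case (Suc M)
  then show ?case by (auto simp: power2_eq_square field_simps)
qed

context coxeter
begin

text \<open>
  The core is \<open>{i0, j0}\<close>. As no letter can be repeated, its reduced words alternate; those of length
  at least \<open>3\<close> turn, and length \<open>M\<close> is excluded by the relators.
\<close>
lemma one_multiple_edge_count:
  assumes tree: "is_tree I E" and e: "{i0, j0} \<in> E"
    and me: "\<And>i j. {i, j} \<in> E \<Longrightarrow> {i, j} \<noteq> {i0, j0} \<Longrightarrow> m i j = 3"
    and M: "m i0 j0 = enat M" and d: "\<And>i. i \<in> I \<Longrightarrow> d i = 2"
    and a: "a = card (component I (E - {{i0, j0}}) i0)"
    and b: "b = card (component I (E - {{i0, j0}}) j0)"
  shows "finite red"
    "real (card red) = (if even M then 1 / 2 * real M * (real (card I))\<^sup>2 + 1 - 2 * real a * real b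
      else 1 / 2 * (real M - 1) * (real (card I))\<^sup>2 + 1)"
proof -
  have ij: "i0 \<in> I" "j0 \<in> I" "i0 \<noteq> j0" "3 \<le> m i0 j0" using e by (auto simp: edge_iff)
  have M': "m j0 i0 = enat M" using M m_sym ij by metis
  have M3: "3 \<le> M" using ij(4) M by (simp add: numeral_eq_enat)
  interpret coxeter_core I m d "{i0, j0}"
  proof unfold_locales
    show "is_tree I E" "finite I" using tree cox by (simp_all add: coxeter_matrix_def)
    show "m i j = 3" if "{i, j} \<in> E" "i \<notin> {i0, j0} \<or> j \<notin> {i0, j0}" for i j
      using that me[of i j] by (auto simp: doubleton_eq_iff)
  qed (use ij e d in \<open>auto simp: insert_commute\<close>)
  have comp: "card (branch x) = card (component I (E - {{x, y}}) x)" if xy: "{x, y} = {i0, j0}" for x y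
  proof -
    have "{x, y} \<in> E" using xy e by simp
    moreover have "branch x = {u. nbw (u @ [x]) \<and> y \<notin> set u}"
      using nbw_distinct[of "u @ [x]" for u] xy by (auto simp: branch_def doubleton_eq_iff)
    ultimately have "(\<lambda>u. hd (u @ [x])) ` branch x = component I (E - {{x, y}}) x"
      by (simp add: component_eq setcompr_eq_image)
    then show ?thesis using card_branch[of x] by simp
  qed
  have ab: "card (branch i0) = a" "card (branch j0) = b"
    using comp[of i0 j0] comp[of j0 i0] by (simp_all add: a b insert_commute)
  have n: "card I = a + b"
    using components_partition[OF e] finV unfolding a b
    by (subst card_Un_disjoint[symmetric]) (auto intro: finite_subset[of _ I] simp: component_def)
  have alt_turn: "alternating x y k \<in> core_turns" if xy: "{x, y} = {i0, j0}" and k: "3 \<le> k" "k < M" for x y k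
  proof -
    have ne: "x \<noteq> y" using xy ij by (auto simp: doubleton_eq_iff)
    have nth: "alternating x y k ! t = (if even t then x else y)" if "t < k" for t
      using that by (rule alternating_nth)
    have "alternating x y k \<in> red"
    proof (rule redI)
      show "set (alternating x y k) \<subseteq> I" using set_alternating[of x y k] xy ij by auto
    next
      fix t i assume i: "i \<in> I" "t + d i \<le> length (alternating x y k)"
        and j: "\<And>j. j < d i \<Longrightarrow> alternating x y k ! (t + j) = i"
      then show False using d[OF i(1)] j[of 0] j[of 1] nth[of t] nth[of "Suc t"] ne
        by (auto simp: length_alternating split: if_splits)
    next
      fix t a b n assume w: "a \<noteq> b" "m a b = enat n" "2 \<le> n" "t + n \<le> length (alternating x y k)"
        and j: "\<And>j. j < n \<Longrightarrow> alternating x y k ! (t + j) = (if even j then a else b)"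
      have "a = alternating x y k ! t" "b = alternating x y k ! Suc t" using j[of 0] j[of 1] w by auto
      then have "{a, b} = {x, y}" using w nth[of t] nth[of "Suc t"] by (auto simp: length_alternating)
      then have "n = M" using w M M' xy by (auto simp: doubleton_eq_iff)
      then show False using w k by (simp add: length_alternating)
    qed
    moreover have "\<not> nbw (alternating x y k)"
      using nbw_no_turn[of "alternating x y k" 0] nth[of 0] nth[of 2] k
      by (auto simp: length_alternating numeral_2_eq_2)
    ultimately show ?thesis using set_alternating[of x y k] xy by (auto simp: core_turns_def)
  qed
  have turn_alt: "length r \<in> {3..<M} \<and> (r = alternating i0 j0 (length r) \<or> r = alternating j0 i0 (length r))"
    if r: "r \<in> core_turns" for r
  proof -
    have r': "r \<in> red" "set r \<subseteq> {i0, j0}" "\<not> nbw r" using r by (auto simp: core_turns_def)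
    have rne: "r \<noteq> []" using core_turns_length[OF r] by auto
    have ne: "r ! t \<noteq> r ! Suc t" if t: "Suc t < length r" for t
    proof -
      have "r ! t \<in> I" using red_set[OF r'(1)] t by auto
      then show ?thesis using red_step[OF r'(1) t] d by (auto simp: edge_iff)
    qed
    have "hd r \<in> {i0, j0}" using r' rne hd_in_set[of r] by blast
    then obtain x y where xy: "{x, y} = {i0, j0}" "hd r = x" "x = i0 \<and> y = j0 \<or> x = j0 \<and> y = i0" by auto
    have req: "r = alternating x y (length r)" using r' xy ne by (intro alternating_eqI) auto
    have "length r < M"
    proof (rule ccontr)
      assume "\<not> ?thesis"
      then have "sublist (alternating x y M) (alternating x y (length r))"
        unfolding sublist_iff_nth by (intro exI[of _ 0]) (simp add: length_alternating alternating_nth)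
      then have "sublist (alternating x y M) r" using req by simp
      moreover have "alternating x y M \<in> forbidden I m d"
        using xy(3) ij M M' by (auto intro: forbidden_alt)
      ultimately show False using red_avoids[OF r'(1)] by simp
    qed
    moreover have "length r \<noteq> 2"
    proof
      assume "length r = 2"
      then have "r = [x, y]" using req by (simp add: alternating_2)
      moreover have "{x, y} \<in> E" using xy e by simp
      ultimately show False using r'(3) edge_in[of x y] by (simp add: nbw_Cons_Cons)
    qed
    ultimately show ?thesis using core_turns_length[OF r] req xy(3) by auto
  qed
  let ?P = "alternating i0 j0 ` {3..<M}" and ?Q = "alternating j0 i0 ` {3..<M}"
  have turns: "core_turns = ?P \<union> ?Q"
  proof
    show "core_turns \<subseteq> ?P \<union> ?Q" using turn_alt by (metis UnCI image_eqI subsetI)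
    show "?P \<union> ?Q \<subseteq> core_turns" using alt_turn by (auto simp: insert_commute)
  qed
  have fin: "finite core_turns" by (simp add: turns)
  have disj: "?P \<inter> ?Q = {}"
  proof (rule ccontr)
    assume "\<not> ?thesis"
    then obtain k l where "3 \<le> k" "3 \<le> l" "alternating i0 j0 k = alternating j0 i0 l" by auto
    then show False using hd_alternating[of k i0 j0] hd_alternating[of l j0 i0] ij by simp
  qed
  have inj: "inj_on (alternating x y) S" for x y :: 'i and S
    by (rule inj_onI) (metis length_alternating)
  have "(\<Sum>r\<in>core_turns. card (branch (hd r)) * card (branch (last r))) =
      (\<Sum>k=3..<M. a * (if odd k then a else b)) + (\<Sum>k=3..<M. b * (if odd k then b else a))"
    unfolding turns using disj
    by (subst sum.union_disjoint; simp add: sum.reindex inj)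
      (intro arg_cong2[where f = "(+)"] sum.cong; simp add: hd_alternating last_alternating ab)
  then have "card red = 1 + (a + b)\<^sup>2 +
      (\<Sum>k=3..<M. a * (if odd k then a else b) + b * (if odd k then b else a))"
    using card_red(2)[OF fin] by (simp add: n sum.distrib)
  then show "real (card red) = (if even M then 1 / 2 * real M * (real (card I))\<^sup>2 + 1 - 2 * real a * real b
      else 1 / 2 * (real M - 1) * (real (card I))\<^sup>2 + 1)"
    using turn_sum[OF M3, of a b] by (simp only: n)
  show "finite red" using card_red(1)[OF fin] .
qed

end

section \<open>Infinite families of reduced words\<close>

context coxeter
begin

text \<open>
  The conditions concern four consecutive letters only. They exclude patterns of which one occurs
  among the first four letters of every relator: a pause at a node with \<open>d i = 2\<close>, a double pause, a
  non-edge, a turn on an edge with \<open>m a b = 3\<close>, or \<open>abab\<close> with finite \<open>m a b\<close>. So the prefixes of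
  the sequence are reduced words of every length.
\<close>
lemma infinite_red_if_sequence:
  fixes s :: "nat \<Rightarrow> 'i"
  assumes step: "\<And>t. {s t, s (Suc t)} \<in> E \<or> s t = s (Suc t) \<and> s t \<in> I \<and> 3 \<le> d (s t)"
    and stay: "\<And>t. s t = s (Suc t) \<Longrightarrow> s (Suc t) \<noteq> s (Suc (Suc t))"
    and turn: "\<And>t. s t \<noteq> s (Suc t) \<Longrightarrow> s t = s (Suc (Suc t)) \<Longrightarrow>
      m (s t) (s (Suc t)) = \<infinity> \<or> 4 \<le> m (s t) (s (Suc t)) \<and> s (Suc t) \<noteq> s (Suc (Suc (Suc t)))"
  shows "infinite red"
proof -
  have "map s [0..<l] \<in> red" for l
  proof (rule redI)
    show "set (map s [0..<l]) \<subseteq> I" using step edge_in by fastforce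
  next
    fix t i assume i: "i \<in> I" "t + d i \<le> length (map s [0..<l])"
      and k: "\<And>k. k < d i \<Longrightarrow> map s [0..<l] ! (t + k) = i"
    have s: "s (t + k) = i" if "k < d i" for k using k[OF that] i that by simp
    have "s t = i" "s (Suc t) = i" using s[of 0] s[of 1] d2[OF i(1)] by auto
    then have "3 \<le> d i" using step[of t] edge_in[of i i] by auto
    then show False using s[of 2] stay[of t] \<open>s t = i\<close> \<open>s (Suc t) = i\<close> by simp
  next
    fix t a b n assume a: "a \<in> I" "b \<in> I" "a \<noteq> b" "m a b = enat n" "2 \<le> n" "t + n \<le> length (map s [0..<l])"
      and k: "\<And>k. k < n \<Longrightarrow> map s [0..<l] ! (t + k) = (if even k then a else b)"
    have s: "s (t + k) = (if even k then a else b)" if "k < n" for k using k[OF that] a that by simp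
    have st: "s t = a" "s (Suc t) = b" using s[of 0] s[of 1] a by auto
    then have "{a, b} \<in> E" using step[of t] a by auto
    then have "3 \<le> n" using a by (simp add: edge_iff numeral_eq_enat)
    then have "s (Suc (Suc t)) = a" using s[of 2] by simp
    then have 4: "4 \<le> n" "b \<noteq> s (Suc (Suc (Suc t)))"
      using turn[of t] st a by (auto simp: numeral_eq_enat)
    then show False using s[of 3] by (simp add: numeral_3_eq_3)
  qed
  then have "range (\<lambda>l. map s [0..<l]) \<subseteq> red" by blast
  moreover have "inj (\<lambda>l. map s [0..<l])"
    by (rule injI) (metis length_map length_upt diff_zero)
  then have "infinite (range (\<lambda>l. map s [0..<l]))" by (simp add: finite_image_iff)
  ultimately show ?thesis using finite_subset by blast
qed

lemma infinite_red_if_infinite_edge: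
  assumes "a \<in> I" "b \<in> I" "a \<noteq> b" "m a b = \<infinity>"
  shows "infinite red"
proof -
  have inf: "m b a = \<infinity>" using assms m_sym by metis
  then have E: "{a, b} \<in> E" "{b, a} \<in> E" using assms by (simp_all add: edge_iff)
  show ?thesis
  proof (rule infinite_red_if_sequence[of "\<lambda>t. if even t then a else b"], goal_cases)
    case (1 t)
    then show ?case using E by simp
  next
    case (2 t)
    then show ?case using assms(3) by (simp split: if_splits)
  next
    case (3 t)
    show ?case by (rule disjI1) (simp add: inf assms(4))
  qed
qed

lemma infinite_red_if_cycle:
  assumes "graph_cycle E c"
  shows "infinite red"
proof -
  let ?n = "length c"
  have c: "3 \<le> ?n" "distinct c" "{last c, hd c} \<in> E"
    and e: "Suc k < ?n \<Longrightarrow> {c ! k, c ! Suc k} \<in> E" for k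
    using assms by (auto simp: graph_cycle_def successively_conv_nth)
  have ne: "c \<noteq> []"
  proof
    assume "c = []"
    then show False using c(1) by simp
  qed
  have pos: "t mod ?n < ?n" for t using ne by (intro mod_less_divisor) simp
  let ?s = "\<lambda>t. c ! (t mod ?n)"
  have eq: "?s t = ?s u \<longleftrightarrow> t mod ?n = u mod ?n" for t u
    using nth_eq_iff_index_eq[OF c(2) pos pos] .
  have ne1: "?s t \<noteq> ?s (Suc t)" "?s t \<noteq> ?s (Suc (Suc t))" for t
    unfolding eq using c(1) by (simp_all add: mod_Suc)
  have "{?s t, ?s (Suc t)} \<in> E" for t
  proof (cases "Suc (t mod ?n) = ?n")
    case True
    then have "t mod ?n = ?n - 1" by simp
    then show ?thesis using c(3) True ne by (simp add: mod_Suc last_conv_nth hd_conv_nth)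
  next
    case False
    then have "Suc (t mod ?n) < ?n" using pos[of t] by simp
    then show ?thesis using e False by (simp add: mod_Suc)
  qed
  then show ?thesis by (intro infinite_red_if_sequence[of ?s]) (use ne1 in auto)
qed

end

text \<open>
  One step of a walker on the positions \<open>0, ..., n\<close> of a path; the flag tells whether it moves
  upwards. At an end it turns around, after waiting there for one step if that end has a flag \<open>L\<close> or
  \<open>R\<close>. Waiting will be used at a node with \<open>d i \<ge> 3\<close>, turning at once at the end of a multiple edge.
\<close>
fun bounce :: "bool \<Rightarrow> bool \<Rightarrow> nat \<Rightarrow> nat \<times> bool \<Rightarrow> nat \<times> bool" where
  "bounce L R n (k, True) = (if k < n then (Suc k, True) else if R then (k, False) else (k - 1, False))"
| "bounce L R n (k, False) = (if 0 < k then (k - 1, False) else if L then (k, True) else (Suc k, True))"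

context coxeter
begin

text \<open>
  A path from one gadget to another is traversed back and forth. The condition \<open>LR\<close> excludes
  that the two gadgets are the same edge: bouncing on a single edge gives an alternating word, which for
  finite \<open>m a b\<close> is reduced only up to a bounded length.
\<close>
lemma infinite_red_if_two_ends:
  assumes p: "nbw p" "distinct p" and n: "length p = Suc n" "0 < n"
    and L: "if L then 3 \<le> d (p ! 0) else 4 \<le> m (p ! 0) (p ! 1)"
    and R: "if R then 3 \<le> d (p ! n) else 4 \<le> m (p ! n) (p ! (n - 1))"
    and LR: "L \<or> R \<or> 2 \<le> n"
  shows "infinite red"
proof -
  define st where "st t = (bounce L R n ^^ t) (0, True)" for t
  have st_Suc: "st (Suc t) = bounce L R n (st t)" for t by (simp add: st_def)
  have le: "fst (st t) \<le> n" for t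
  proof (induction t)
    case 0
    then show ?case by (simp add: st_def)
  next
    case (Suc t)
    then show ?case using n(2) by (cases "(L, R, n, st t)" rule: bounce.cases) (auto simp: st_Suc)
  qed
  let ?s = "\<lambda>t. p ! fst (st t)"
  have eq: "?s t = ?s u \<longleftrightarrow> fst (st t) = fst (st u)" for t u
    using nth_eq_iff_index_eq[OF p(2)] le n by (simp add: less_Suc_eq_le)
  have edge: "{p ! k, p ! Suc k} \<in> E" if "k < n" for k
    using nbw_edge[OF p(1)] that n by simp
  have edge': "{p ! k, p ! (k - 1)} \<in> E" if "k \<le> n" "0 < k" for k
    using edge[of "k - 1"] that by (simp add: insert_commute)
  have pI: "p ! k \<in> I" if "k \<le> n" for k using p(1) n that by (auto simp: nbw_def)
  show ?thesis
  proof (rule infinite_red_if_sequence[of ?s])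
    fix t
    obtain k up where k: "st t = (k, up)" by (metis surj_pair)
    have kn: "k \<le> n" using le[of t] k by simp
    show "{?s t, ?s (Suc t)} \<in> E \<or> ?s t = ?s (Suc t) \<and> ?s t \<in> I \<and> 3 \<le> d (?s t)"
      using kn L R n(2) edge edge' pI by (cases up) (auto simp: st_Suc k)
    show "?s (Suc t) \<noteq> ?s (Suc (Suc t))" if "?s t = ?s (Suc t)"
      using that kn n(2) unfolding eq by (cases up) (auto simp: st_Suc k split: if_splits)
    show "m (?s t) (?s (Suc t)) = \<infinity> \<or> 4 \<le> m (?s t) (?s (Suc t)) \<and> ?s (Suc t) \<noteq> ?s (Suc (Suc (Suc t)))"
      if "?s t \<noteq> ?s (Suc t)" "?s t = ?s (Suc (Suc t))"
    proof (cases up)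
      case True
      then have "k = n - 1" "\<not> R" using that kn n(2) LR unfolding eq by (auto simp: st_Suc k split: if_splits)
      moreover have "4 \<le> m (p ! (n - 1)) (p ! n)" using R \<open>\<not> R\<close> m_sym[OF pI[of n] pI[of "n - 1"]] by simp
      ultimately show ?thesis using True n(2) LR unfolding eq by (auto simp: st_Suc k split: if_splits)
    next
      case False
      then have "k = 1" "\<not> L" using that kn n(2) LR unfolding eq by (auto simp: st_Suc k split: if_splits)
      moreover have "4 \<le> m (p ! 1) (p ! 0)" using L \<open>\<not> L\<close> m_sym[OF pI[of 0] pI[of 1]] n(2) by simp
      ultimately show ?thesis using False n(2) LR unfolding eq by (auto simp: st_Suc k split: if_splits)
    qed
  qed
qed

end

context tree
begin

text \<open>
  Walk to \<open>a\<close>. Either the walk has arrived through \<open>b\<close>, or it can be continued to \<open>b\<close>.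
\<close>
lemma path_to_edge:
  assumes "x \<in> V" "{a, b} \<in> E"
  obtains p n where "nbw p" "length p = Suc n" "0 < n" "p ! 0 = x" "{p ! n, p ! (n - 1)} = {a, b}"
proof -
  have ab: "a \<in> V" "b \<in> V" "a \<noteq> b" using edge_in[OF assms(2)] by auto
  obtain q where q: "nbw q" "q \<noteq> []" "hd q = x" "last q = a" using nbw_connect assms(1) ab by blast
  obtain q' where q': "q = q' @ [a]" using q by (metis append_butlast_last_id)
  show thesis
  proof (cases "q' \<noteq> [] \<and> last q' = b")
    case True
    then show thesis using q q'
      by (intro that[of q "length q'"]) (auto simp: nth_append hd_conv_nth last_conv_nth)
  next
    case False
    have "nbw [a, b]" using assms(2) ab by (simp add: nbw_Cons_Cons)
    with False q(1) q' have "nbw (q' @ [a, b])" using nbw_glue[of q' a "[b]"] by auto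
    then show thesis using q q'
      by (intro that[of "q' @ [a, b]" "Suc (length q')"]) (auto simp: nth_append hd_conv_nth hd_append)
  qed
qed

end

context coxeter
begin

text \<open>
  In each case a path is needed that joins the two gadgets, containing those which are edges as its
  first or last step.
\<close>
lemma infinite_red_if_two_gadgets:
  assumes tree: "is_tree I E"
  shows "x \<in> I \<Longrightarrow> y \<in> I \<Longrightarrow> x \<noteq> y \<Longrightarrow> 3 \<le> d x \<Longrightarrow> 3 \<le> d y \<Longrightarrow> infinite red"
    and "x \<in> I \<Longrightarrow> 3 \<le> d x \<Longrightarrow> e \<in> multiple_edges I m \<Longrightarrow> infinite red"
    and "e \<in> multiple_edges I m \<Longrightarrow> e' \<in> multiple_edges I m \<Longrightarrow> e \<noteq> e' \<Longrightarrow> infinite red"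
proof -
  interpret tree I E
    using tree cox by unfold_locales (simp_all add: coxeter_matrix_def)
  have meE: "e \<in> E" if e: "e \<in> multiple_edges I m" for e
  proof -
    have "(3::enat) \<le> m i j" if "4 \<le> m i j" for i j using that by (rule order_trans[rotated]) simp
    then show ?thesis using e by (auto simp: multiple_edges_def edge_iff)
  qed
  have me: "4 \<le> m a b" if "{a, b} \<in> multiple_edges I m" for a b
    using that m_sym by (auto simp: multiple_edges_def doubleton_eq_iff)
  show "infinite red" if xy: "x \<in> I" "y \<in> I" "x \<noteq> y" "3 \<le> d x" "3 \<le> d y"
  proof -
    obtain p where p: "nbw p" "p \<noteq> []" "hd p = x" "last p = y" using nbw_connect xy(1,2) by blast
    then obtain n where n: "length p = Suc n" by (cases p) auto
    have "p ! 0 = x" "p ! n = y" using p n by (auto simp: hd_conv_nth last_conv_nth)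
    moreover from this have "0 < n" using xy(3) by (cases n) auto
    ultimately show ?thesis
      using infinite_red_if_two_ends[of p n True True] p n xy nbw_distinct by simp
  qed
  show "infinite red" if x: "x \<in> I" "3 \<le> d x" and e: "e \<in> multiple_edges I m"
  proof -
    obtain a b where ab: "e = {a, b}" "{a, b} \<in> E" using meE[OF e] edgeE by metis
    obtain p n where p: "nbw p" "length p = Suc n" "0 < n" "p ! 0 = x" "{p ! n, p ! (n - 1)} = {a, b}"
      using path_to_edge[OF x(1) ab(2)] .
    then have "4 \<le> m (p ! n) (p ! (n - 1))" using me e ab by simp
    then show ?thesis
      using infinite_red_if_two_ends[of p n True False] p x nbw_distinct by simp
  qed
  show "infinite red" if e: "e \<in> multiple_edges I m" "e' \<in> multiple_edges I m" "e \<noteq> e'"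
  proof -
    obtain a b where ab: "e = {a, b}" "{a, b} \<in> E" using meE[OF e(1)] edgeE by metis
    obtain c c' where c: "e' = {c, c'}" "{c, c'} \<in> E" using meE[OF e(2)] edgeE by metis
    have "a \<in> I" "b \<in> I" "a \<noteq> b" using edge_in[OF ab(2)] by auto
    obtain p n where p: "nbw p" "length p = Suc n" "0 < n" "p ! 0 = a" "{p ! n, p ! (n - 1)} = {c, c'}"
      using path_to_edge[OF \<open>a \<in> I\<close> c(2)] .
    have R: "4 \<le> m (p ! n) (p ! (n - 1))" using me e p(5) c by simp
    \<comment> \<open>The path leads from \<open>a\<close> to the second edge; prepend \<open>b\<close> unless it starts with the first edge.\<close>
    show ?thesis
    proof (cases "p ! 1 = b")
      case True
      have "n \<noteq> 1"
      proof
        assume "n = 1"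
        then have "e' = {b, a}" using p(4,5) c(1) True by simp
        then show False using e(3) ab(1) by auto
      qed
      moreover have "4 \<le> m (p ! 0) (p ! 1)" using True p(4) e(1) ab(1) me[of a b] by simp
      ultimately show ?thesis
        using infinite_red_if_two_ends[of p n False False] p(1-3) R nbw_distinct by simp
    next
      case False
      obtain q where q: "p = a # q" "q \<noteq> []" using p by (cases p) auto
      moreover have "{b, a} \<in> E" using ab(2) by (simp add: insert_commute)
      moreover have "hd q \<noteq> b" using False q by (simp add: hd_conv_nth)
      ultimately have "nbw (b # p)" using p(1) by (auto simp: nbw_Cons_Cons)
      moreover have "{b, a} \<in> multiple_edges I m" using e(1) ab(1) by (simp add: insert_commute)
      then have "4 \<le> m b a" by (rule me)
      ultimately show ?thesis
        using infinite_red_if_two_ends[of "b # p" "Suc n" False False] p(2-4) R nbw_distinct[of "b # p"]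
        by simp
    qed
  qed
qed

lemma finite_red_cases:
  assumes conn: "connected_graph I E" and fin: "finite red"
  shows "(\<exists>i0 j0. one_multiple_edge_case I m d i0 j0) \<or> simply_laced_case I m d"
proof -
  have tree: "is_tree I E" using conn fin infinite_red_if_cycle by (auto simp: is_tree_def)
  note gadgets = infinite_red_if_two_gadgets[OF tree]
  show ?thesis
  proof (cases "multiple_edges I m = {}")
    case True
    have "m i j \<le> 3" if "i \<in> I" "j \<in> I" for i j
    proof (cases "i = j")
      case True
      then show ?thesis using cox that by (simp add: coxeter_matrix_def)
    next
      case False
      then have "\<not> 4 \<le> m i j" using \<open>multiple_edges I m = {}\<close> that by (auto simp: multiple_edges_def)
      then show ?thesis by (cases "m i j") (auto simp: numeral_eq_enat)
    qed
    then show ?thesis using tree gadgets(1) fin by (auto simp: simply_laced_case_def simply_laced_def)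
  next
    case False
    then obtain e where e: "e \<in> multiple_edges I m" by blast
    then obtain i0 j0 where ij: "e = {i0, j0}" "i0 \<in> I" "j0 \<in> I" "i0 \<noteq> j0" "4 \<le> m i0 j0"
      by (auto simp: multiple_edges_def)
    have "multiple_edges I m = {{i0, j0}}" using gadgets(3)[OF e] fin e ij by blast
    moreover have "m i0 j0 < \<infinity>" using infinite_red_if_infinite_edge[OF ij(2-4)] fin by auto
    moreover have "d i = 2" if "i \<in> I" for i using gadgets(2)[OF that _ e] fin d2[OF that] by force
    ultimately show ?thesis using tree ij unfolding one_multiple_edge_case_def by blast
  qed
qed

end

section \<open>Classification and dimension formulas\<close>

lemma nil_hecke_relators_empty:
  "nil_hecke_relators K I m d {} = word_monom K ` forbidden I m d"
  unfolding nil_hecke_relators_def forbidden_def by blast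

context coxeter
begin

lemma braid_pairs_lt_empty: "k \<le> 2 \<Longrightarrow> braid_pairs_lt I m k = {}"
proof -
  assume k: "k \<le> 2"
  have False if "{a, b} \<in> braid_pairs I m" "m a b < enat k" for a b
  proof -
    have "a \<in> I" "b \<in> I" "a \<noteq> b" using that(1) by (auto simp: braid_pairs_def doubleton_eq_iff)
    then have "enat 2 \<le> m a b" using m_ge2 by (simp add: numeral_eq_enat)
    also have "\<dots> < enat k" by (rule that(2))
    finally show False using k by simp
  qed
  then show ?thesis unfolding braid_pairs_lt_def by blast
qed

lemma one_multiple_edge_case_count:
  assumes c: "one_multiple_edge_case I m d i0 j0" and M: "m i0 j0 = enat M"
    and a: "a = card (component I (E - {{i0, j0}}) i0)"
    and b: "b = card (component I (E - {{i0, j0}}) j0)"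
  shows "finite red"
    "real (card red) = (if even M then 1 / 2 * real M * (real (card I))\<^sup>2 + 1 - 2 * real a * real b
      else 1 / 2 * (real M - 1) * (real (card I))\<^sup>2 + 1)"
proof -
  have tree: "is_tree I E" and me: "multiple_edges I m = {{i0, j0}}" and d: "\<And>i. i \<in> I \<Longrightarrow> d i = 2"
    and m4: "4 \<le> m i0 j0"
    using c by (auto simp: one_multiple_edge_case_def)
  have "{i0, j0} \<in> multiple_edges I m" by (simp add: me)
  then have "i0 \<in> I" "j0 \<in> I" "i0 \<noteq> j0" by (auto simp: multiple_edges_def doubleton_eq_iff)
  moreover have "(3::enat) \<le> m i0 j0" using m4 by (rule order_trans[rotated]) simp
  ultimately have e: "{i0, j0} \<in> E" by (simp add: edge_iff)
  have "m i j = 3" if ij: "{i, j} \<in> E" "{i, j} \<noteq> {i0, j0}" for i j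
  proof -
    have "{i, j} \<notin> multiple_edges I m" using ij(2) me by blast
    then have "\<not> 4 \<le> m i j" using ij(1) unfolding multiple_edges_def edge_iff by blast
    then show ?thesis using ij(1) by (cases "m i j") (auto simp: edge_iff numeral_eq_enat)
  qed
  note count = one_multiple_edge_count[OF tree e this M d a b]
  show "finite red" by (rule count(1))
  show "real (card red) = (if even M then 1 / 2 * real M * (real (card I))\<^sup>2 + 1 - 2 * real a * real b
      else 1 / 2 * (real M - 1) * (real (card I))\<^sup>2 + 1)" by (rule count(2))
qed

text \<open>
  For \<open>I = {}\<close> there is no node to serve as the core; the empty word is then the only word.
\<close>
lemma simply_laced_case_count:
  assumes c: "simply_laced_case I m d"
  shows "i0 \<in> I \<Longrightarrow> 3 \<le> d i0 \<Longrightarrow> finite red \<and> card red = 1 + card I ^ 2 * (d i0 - 1)"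
    and "\<forall>i\<in>I. d i < 3 \<Longrightarrow> finite red \<and> card red = 1 + card I ^ 2"
proof -
  have tree: "is_tree I E" and sl: "simply_laced I m"
    and one: "\<And>i j. i \<in> I \<Longrightarrow> j \<in> I \<Longrightarrow> 3 \<le> d i \<Longrightarrow> 3 \<le> d j \<Longrightarrow> i = j"
    using c by (auto simp: simply_laced_case_def)
  show "finite red \<and> card red = 1 + card I ^ 2 * (d i0 - 1)" if i0: "i0 \<in> I" "3 \<le> d i0"
  proof -
    have "d i = 2" if "i \<in> I" "i \<noteq> i0" for i
      using one[OF that(1) i0(1)] that d2[OF that(1)] i0(2) by force
    then show ?thesis using simply_laced_count[OF tree sl i0(1)] by blast
  qed
  show "finite red \<and> card red = 1 + card I ^ 2" if d: "\<forall>i\<in>I. d i < 3"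
  proof (cases "I = {}")
    case True
    then have "red = {[]}" using forbidden_not_Nil by (auto simp: reduced_words_def)
    then show ?thesis using True by simp
  next
    case False
    then obtain i0 where i0: "i0 \<in> I" by blast
    have d': "d i = 2" if "i \<in> I" for i using d d2 that by force
    show ?thesis using simply_laced_count[OF tree sl i0 d'] d'[OF i0] by simp
  qed
qed

lemma finite_red_iff:
  assumes "connected_graph I E"
  shows "finite red \<longleftrightarrow> (\<exists>i0 j0. one_multiple_edge_case I m d i0 j0) \<or> simply_laced_case I m d"
proof
  assume "(\<exists>i0 j0. one_multiple_edge_case I m d i0 j0) \<or> simply_laced_case I m d"
  then show "finite red"
  proof (elim disjE exE)
    fix i0 j0 assume c: "one_multiple_edge_case I m d i0 j0"
    then obtain M where "m i0 j0 = enat M" by (cases "m i0 j0") (auto simp: one_multiple_edge_case_def)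
    then show ?thesis using one_multiple_edge_case_count(1)[OF c] by blast
  next
    assume c: "simply_laced_case I m d"
    show ?thesis
    proof (cases "\<exists>i\<in>I. 3 \<le> d i")
      case True
      then show ?thesis using simply_laced_case_count(1)[OF c] by blast
    next
      case False
      then show ?thesis using simply_laced_case_count(2)[OF c] by (simp add: not_le)
    qed
  qed
qed (rule finite_red_cases[OF assms])

lemma cases_exclusive:
  "\<not> ((\<exists>i0 j0. one_multiple_edge_case I m d i0 j0) \<and> simply_laced_case I m d)"
proof
  assume "(\<exists>i0 j0. one_multiple_edge_case I m d i0 j0) \<and> simply_laced_case I m d"
  then obtain i0 j0 where me: "multiple_edges I m = {{i0, j0}}" and sl: "simply_laced I m"
    unfolding one_multiple_edge_case_def simply_laced_case_def by blast
  then have "{i0, j0} \<in> multiple_edges I m" by simp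
  then obtain i j where "i \<in> I" "j \<in> I" "4 \<le> m i j" unfolding multiple_edges_def by blast
  then have "(4::enat) \<le> 3" using sl unfolding simply_laced_def by (meson order_trans)
  then show False by simp
qed

end

theorem theorem1:
  fixes K :: "('k, 'r) ring_scheme"
    and I :: "'i set"
    and m :: "'i \<Rightarrow> 'i \<Rightarrow> enat"
    and d :: "'i \<Rightarrow> nat"
  assumes "cring K" and "\<one>\<^bsub>K\<^esub> \<noteq> \<zero>\<^bsub>K\<^esub>"
    and "coxeter_matrix I m"
    and "connected_graph I (coxeter_edges I m)"
    and "\<forall>i\<in>I. 2 \<le> d i"
  shows
    "nil_hecke K I m d (braid_pairs_lt I m 1) = nil_hecke K I m d (braid_pairs_lt I m 2) \<and>
     (fin_gen_module K (nil_hecke K I m d (braid_pairs_lt I m 2)) \<longleftrightarrow>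
        ((\<exists>i0 j0. one_multiple_edge_case I m d i0 j0) \<or> simply_laced_case I m d) \<and>
        \<not> ((\<exists>i0 j0. one_multiple_edge_case I m d i0 j0) \<and> simply_laced_case I m d)) \<and>
     (\<forall>i0 j0 M a b.
        one_multiple_edge_case I m d i0 j0 \<and> m i0 j0 = enat M \<and>
        a = card (component I (coxeter_edges I m - {{i0, j0}}) i0) \<and>
        b = card (component I (coxeter_edges I m - {{i0, j0}}) j0) \<longrightarrow>
        (\<exists>n. free_of_rank K (nil_hecke K I m d (braid_pairs_lt I m 2)) n \<and>
           real n =
             (if even M
              then 1 / 2 * real M * real (card I) ^ 2 + 1 - 2 * real a * real b
              else 1 / 2 * (real M - 1) * real (card I) ^ 2 + 1))) \<and>
     (simply_laced_case I m d \<longrightarrow>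
        (\<forall>i0\<in>I. 3 \<le> d i0 \<longrightarrow>
           free_of_rank K (nil_hecke K I m d (braid_pairs_lt I m 2))
             (1 + card I ^ 2 * (d i0 - 1))) \<and>
        ((\<forall>i\<in>I. d i < 3) \<longrightarrow>
           free_of_rank K (nil_hecke K I m d (braid_pairs_lt I m 2))
             (1 + card I ^ 2 * (2 - 1))))"
proof -
  interpret coxeter I m d using assms by unfold_locales auto
  interpret monomial_algebra K I "forbidden I m d"
    using assms(1,2) forbidden_lists
    by (intro monomial_algebra.intro monomial_algebra_axioms.intro)
  have H: "nil_hecke K I m d (braid_pairs_lt I m k) = Q" if "k \<le> 2" for k
    unfolding braid_pairs_lt_empty[OF that] nil_hecke_def nil_hecke_relators_empty N_def ..
  have fg: "fin_gen_module K Q \<longleftrightarrow> finite red"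
    using finite_if_fin_gen free_of_rank_card fin_gen_if_free by blast
  have fr: "free_of_rank K Q n" if "finite red \<and> card red = n" for n
    using free_of_rank_card that by blast
  have H1: "nil_hecke K I m d (braid_pairs_lt I m 1) = Q"
    and H2: "nil_hecke K I m d (braid_pairs_lt I m 2) = Q"
    by (simp_all add: H)
  show ?thesis
    unfolding H1 H2
  proof (intro conjI allI impI ballI)
    show "fin_gen_module K Q \<longleftrightarrow>
        ((\<exists>i0 j0. one_multiple_edge_case I m d i0 j0) \<or> simply_laced_case I m d) \<and>
        \<not> ((\<exists>i0 j0. one_multiple_edge_case I m d i0 j0) \<and> simply_laced_case I m d)"
      using fg finite_red_iff[OF assms(4)] cases_exclusive by blast
  next
    fix i0 j0 M a b
    assume "one_multiple_edge_case I m d i0 j0 \<and> m i0 j0 = enat M \<and>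
      a = card (component I (E - {{i0, j0}}) i0) \<and> b = card (component I (E - {{i0, j0}}) j0)"
    then have c: "one_multiple_edge_case I m d i0 j0" "m i0 j0 = enat M"
      "a = card (component I (E - {{i0, j0}}) i0)" "b = card (component I (E - {{i0, j0}}) j0)"
      by blast+
    show "\<exists>n. free_of_rank K Q n \<and> real n =
       (if even M then 1 / 2 * real M * real (card I) ^ 2 + 1 - 2 * real a * real b
        else 1 / 2 * (real M - 1) * real (card I) ^ 2 + 1)"
      using one_multiple_edge_case_count[OF c] fr by blast
  next
    fix i0 assume "simply_laced_case I m d" "i0 \<in> I" "3 \<le> d i0"
    then show "free_of_rank K Q (1 + card I ^ 2 * (d i0 - 1))"
      using simply_laced_case_count(1) by (intro fr)
  next
    assume "simply_laced_case I m d" "\<forall>i\<in>I. d i < 3"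
    then show "free_of_rank K Q (1 + card I ^ 2 * (2 - 1))"
      using simply_laced_case_count(2) by (intro fr) simp
  qed simp
qed

end
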